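(* Fix $\varepsilon\in(0,\varepsilon_{\max})$, write $\Omega=\Omega_\varepsilon$, $\mathbf B=\mathbf B_\varepsilon$, $\lambda=\lambda_R(\cdot;\varepsilon)$, $w=(w_1,w_2)=w_R(\cdot;\varepsilon)$, and let $v\in\mathbb R$. Put $\vartheta_i(\tau)=(g_i(\tau)-w_i(\tau))\exp(-\int_\tau^v\lambda)$, $i=1,2$. Let $f$ satisfy the regularity condition stated in the context and let $\mathfrak K=\kappa_3'/\kappa_2'$, where $\kappa_2=g_2'/g_1'$, $\kappa_3=f'/g_1'$. If $\int_{-\infty}^v\lambda=+\infty$, $\lim_{\tau\to-\infty}\vartheta_1(\tau)=0$, $\lim_{\tau\to-\infty}\vartheta_2(\tau)\neq0$ and $\lim_{\tau\to-\infty}\mathfrak K(\tau)=+\infty$, then $\mathbf B(x;f)=+\infty$ for every $x\in\Omega\setminus\partial_{\rm fixed}\Omega$.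
   Context: Domains. Let $0<\varepsilon_{\max}\le\infty$ and let $\mathbf g(\cdot;\varepsilon)=(\mathbf g_1,\mathbf g_2):\mathbb R\to\mathbb R^2$, $0\le\varepsilon<\varepsilon_{\max}$, be $C^3$ curves, $C^{3,1}$-smooth in $(t,\varepsilon)$ (the mixed derivative $\partial_t^3\partial_\varepsilon\mathbf g$ is continuous), such that for every $\varepsilon$ (primes denote $\partial_t$) $\mathbf g_1'>0$ and $\mathbf g_2''\mathbf g_1'-\mathbf g_2'\mathbf g_1''>0$. Put $g(t)=(g_1(t),g_2(t))=\mathbf g(t;0)$ and $\Xi_\varepsilon=\{(\mathbf g_1(t;\varepsilon),x_2):t\in\mathbb R,\ x_2>\mathbf g_2(t;\varepsilon)\}$. Assume that for $\varepsilon_1<\varepsilon_2$ one has $\Xi_{\varepsilon_1}\supset\Xi_{\varepsilon_2}$ and $\mathbf g(t;\varepsilon_1)\notin\overline{\Xi_{\varepsilon_2}}$ for all $t$. Assume that for every $\varepsilon\in(0,\varepsilon_{\max})$ and $t\in\mathbb R$ there are two tangent lines from $g(t)$ to $\Xi_\varepsilon$, each meeting the curve $g(\cdot)$ twice. Let $w_L(t;\varepsilon)=\mathbf g(s_L;\varepsilon)$ and $w_R(t;\varepsilon)=\mathbf g(s_R;\varepsilon)$, $s_R<s_L$, be the tangency points, $S_L(t;\varepsilon)=[g(t),w_L(t;\varepsilon)]$, $S_R(t;\varepsilon)=[g(t),w_R(t;\varepsilon)]$ the tangent segments, and $\kappa_L,\kappa_R$ their slopes; assume $\partial_\varepsilon\kappa_L\ne0$,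 $\partial_\varepsilon\kappa_R\neq 0$ everywhere. Let $T_\varepsilon(t)$ be the closed curvilinear triangle with vertex $g(t)$ bounded by $S_L(t;\varepsilon)$, $S_R(t;\varepsilon)$ and the arc of $\mathbf g(\cdot;\varepsilon)$ between the two tangency points, and $\Omega_\varepsilon=\bigcup_{t}T_\varepsilon(t)$. The fixed boundary is $\partial_{\rm fixed}\Omega_\varepsilon=g(\mathbb R)$. The scalar function $\lambda_R(t;\varepsilon)>0$ is defined by $\lambda_R(t)(g(t)-w_R(t))=w_R'(t)$. Regularity condition on $f:\mathbb R\to\mathbb R$: $f\in C^2(\mathbb R)$ and $\mathfrak K$ is piecewise monotone with finitely many monotonicity intervals. The functions $\vartheta_1,\vartheta_2$ are monotone near $-\infty$ and have finite limits there. Bellman function. For an interval $I$, $\mathbf A_{\Omega_\varepsilon}(I)$ is the class of summable $\varphi:I\to\partial_{\rm fixed}\Omega_\varepsilon$ with average $\langle\varphi\rangle_J\in\Omega_\varepsilon$ for every subinterval $J\subset I$. Let $\mathrm f(g(t))=f(t)$; $\mathbf B_\varepsilon(x;f)=\sup\{\langle \mathrm f(\varphi)\rangle_I:\ \langle\varphi\rangle_I=x,\ \varphi\in\mathbf A_{\Omega_\varepsilon}(I)\}$ (independent of $I$), the supremum being over those $\varphi$ for which the average makes sense in $[-\infty,+\infty]$. *)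

theory Defs
  imports "HOL-Analysis.Analysis"
begin

section \<open>The family of curves and the domains\<close>

text \<open>
  A family of plane curves is a function \<open>G\<close>, where \<open>G t e\<close> is the point with
  parameter \<open>t\<close> on the curve number \<open>e\<close>; the fixed boundary is the curve number \<open>0\<close>.
\<close>

definition eps_range :: "ereal \<Rightarrow> real set" where
  "eps_range emax = {e. 0 \<le> e \<and> ereal e < emax}"

text \<open>
  Here \<open>D i j\<close> is the derivative of \<open>G\<close> of order \<open>i\<close> in \<open>t\<close> and of order \<open>j\<close> in \<open>e\<close>
  (at \<open>e = 0\<close> the derivative in \<open>e\<close> is one-sided).
\<close>

definition C31_smooth :: "ereal \<Rightarrow> (real \<Rightarrow> real \<Rightarrow> real \<times> real) \<Rightarrow> bool" where
  "C31_smooth emax G \<longleftrightarrow>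
     (\<exists>D :: nat \<Rightarrow> nat \<Rightarrow> real \<Rightarrow> real \<Rightarrow> real \<times> real.
        D 0 0 = G \<and>
        (\<forall>i\<le>3. \<forall>j\<le>1. continuous_on (UNIV \<times> eps_range emax) (\<lambda>(t, e). D i j t e)) \<and>
        (\<forall>i<3. \<forall>j\<le>1. \<forall>t. \<forall>e\<in>eps_range emax.
           ((\<lambda>s. D i j s e) has_vector_derivative D (Suc i) j t e) (at t)) \<and>
        (\<forall>i\<le>3. \<forall>t. \<forall>e\<in>eps_range emax.
           (D i 0 t has_vector_derivative D i 1 t e) (at e within eps_range emax)))"

definition crv1 :: "(real \<Rightarrow> real \<Rightarrow> real \<times> real) \<Rightarrow> real \<Rightarrow> real \<Rightarrow> real" where
  "crv1 G e t = fst (G t e)"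

definition crv2 :: "(real \<Rightarrow> real \<Rightarrow> real \<times> real) \<Rightarrow> real \<Rightarrow> real \<Rightarrow> real" where
  "crv2 G e t = snd (G t e)"

definition Xi :: "(real \<Rightarrow> real \<Rightarrow> real \<times> real) \<Rightarrow> real \<Rightarrow> (real \<times> real) set" where
  "Xi G e = {(crv1 G e t, x2) | t x2. crv2 G e t < x2}"

definition fixed_boundary :: "(real \<Rightarrow> real \<Rightarrow> real \<times> real) \<Rightarrow> (real \<times> real) set" where
  "fixed_boundary G = range (\<lambda>t. G t 0)"

definition tangent_line :: "(real \<Rightarrow> real \<Rightarrow> real \<times> real) \<Rightarrow> real \<Rightarrow> real \<Rightarrow> (real \<times> real) set" where
  "tangent_line G e s = range (\<lambda>r. G s e + r *\<^sub>R vector_derivative (\<lambda>t. G t e) (at s))"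

definition tangents_from :: "(real \<Rightarrow> real \<Rightarrow> real \<times> real) \<Rightarrow> real \<Rightarrow> real \<Rightarrow> (real \<times> real) set set" where
  "tangents_from G e t = {l. (\<exists>s. l = tangent_line G e s) \<and> G t 0 \<in> l}"

text \<open>
  By strict convexity different parameters \<open>s\<close> give different tangent lines, so if there are
  exactly two tangent lines from \<open>G t 0\<close>, then the set below has exactly two elements.
  The smaller one belongs to the tangent with index R, the larger one to that with index L.
\<close>

definition tangency_params :: "(real \<Rightarrow> real \<Rightarrow> real \<times> real) \<Rightarrow> real \<Rightarrow> real \<Rightarrow> real set" where
  "tangency_params G e t = {s. G t 0 \<in> tangent_line G e s}"

definition s_R :: "(real \<Rightarrow> real \<Rightarrow> real \<times> real) \<Rightarrow> real \<Rightarrow> real \<Rightarrow> real" where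
  "s_R G e t = Min (tangency_params G e t)"

definition s_L :: "(real \<Rightarrow> real \<Rightarrow> real \<times> real) \<Rightarrow> real \<Rightarrow> real \<Rightarrow> real" where
  "s_L G e t = Max (tangency_params G e t)"

definition w_R :: "(real \<Rightarrow> real \<Rightarrow> real \<times> real) \<Rightarrow> real \<Rightarrow> real \<Rightarrow> real \<times> real" where
  "w_R G e t = G (s_R G e t) e"

definition w_L :: "(real \<Rightarrow> real \<Rightarrow> real \<times> real) \<Rightarrow> real \<Rightarrow> real \<Rightarrow> real \<times> real" where
  "w_L G e t = G (s_L G e t) e"

definition slope :: "real \<times> real \<Rightarrow> real \<times> real \<Rightarrow> real" where
  "slope p q = (snd q - snd p) / (fst q - fst p)"

definition kappa_R :: "(real \<Rightarrow> real \<Rightarrow> real \<times> real) \<Rightarrow> real \<Rightarrow> real \<Rightarrow> real" where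
  "kappa_R G e t = slope (G t 0) (w_R G e t)"

definition kappa_L :: "(real \<Rightarrow> real \<Rightarrow> real \<times> real) \<Rightarrow> real \<Rightarrow> real \<Rightarrow> real" where
  "kappa_L G e t = slope (G t 0) (w_L G e t)"

definition triangle_boundary :: "(real \<Rightarrow> real \<Rightarrow> real \<times> real) \<Rightarrow> real \<Rightarrow> real \<Rightarrow> (real \<times> real) set" where
  "triangle_boundary G e t =
     closed_segment (G t 0) (w_L G e t) \<union> closed_segment (G t 0) (w_R G e t) \<union>
     (\<lambda>s. G s e) ` {s_R G e t .. s_L G e t}"

definition triangle :: "(real \<Rightarrow> real \<Rightarrow> real \<times> real) \<Rightarrow> real \<Rightarrow> real \<Rightarrow> (real \<times> real) set" where
  "triangle G e t = triangle_boundary G e t \<union> inside (triangle_boundary G e t)"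

definition Omega :: "(real \<Rightarrow> real \<Rightarrow> real \<times> real) \<Rightarrow> real \<Rightarrow> (real \<times> real) set" where
  "Omega G e = (\<Union>t. triangle G e t)"

locale curve_family =
  fixes emax :: ereal and G :: "real \<Rightarrow> real \<Rightarrow> real \<times> real"
  assumes emax_pos: "0 < emax"
    and smooth: "C31_smooth emax G"
    and deriv_crv1_pos: "\<And>e t. e \<in> eps_range emax \<Longrightarrow> deriv (crv1 G e) t > 0"
    and convex_curve: "\<And>e t. e \<in> eps_range emax \<Longrightarrow>
       deriv (deriv (crv2 G e)) t * deriv (crv1 G e) t
         - deriv (crv2 G e) t * deriv (deriv (crv1 G e)) t > 0"
    and Xi_mono: "\<And>e1 e2. e1 \<in> eps_range emax \<Longrightarrow> e2 \<in> eps_range emax \<Longrightarrow> e1 < e2 \<Longrightarrow>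
       Xi G e2 \<subseteq> Xi G e1"
    and Xi_strict: "\<And>e1 e2 t. e1 \<in> eps_range emax \<Longrightarrow> e2 \<in> eps_range emax \<Longrightarrow> e1 < e2 \<Longrightarrow>
       G t e1 \<notin> closure (Xi G e2)"
    and two_tangents: "\<And>e t. 0 < e \<Longrightarrow> ereal e < emax \<Longrightarrow> card (tangents_from G e t) = 2"
    and tangents_meet_twice: "\<And>e t l. 0 < e \<Longrightarrow> ereal e < emax \<Longrightarrow> l \<in> tangents_from G e t \<Longrightarrow>
       card (l \<inter> fixed_boundary G) = 2"
    and kappa_R_deriv: "\<And>e t. 0 < e \<Longrightarrow> ereal e < emax \<Longrightarrow>
       \<exists>d. d \<noteq> 0 \<and> ((\<lambda>\<epsilon>. kappa_R G \<epsilon> t) has_real_derivative d) (at e)"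
    and kappa_L_deriv: "\<And>e t. 0 < e \<Longrightarrow> ereal e < emax \<Longrightarrow>
       \<exists>d. d \<noteq> 0 \<and> ((\<lambda>\<epsilon>. kappa_L G \<epsilon> t) has_real_derivative d) (at e)"

definition lambda_R :: "(real \<Rightarrow> real \<Rightarrow> real \<times> real) \<Rightarrow> real \<Rightarrow> real \<Rightarrow> real" where
  "lambda_R G e t =
     (THE l. l *\<^sub>R (G t 0 - w_R G e t) = vector_derivative (w_R G e) (at t))"

text \<open>The integral below is oriented, so that the formula is also meant for \<open>\<tau> > v\<close>.\<close>

definition theta_R :: "(real \<Rightarrow> real \<Rightarrow> real \<times> real) \<Rightarrow> real \<Rightarrow> real \<Rightarrow> real \<Rightarrow> real \<times> real" where
  "theta_R G e v \<tau> =
     exp (- (LBINT s=ereal \<tau>..ereal v. lambda_R G e s)) *\<^sub>R (G \<tau> 0 - w_R G e \<tau>)"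


section \<open>The boundary function\<close>

definition kappa2 :: "(real \<Rightarrow> real \<Rightarrow> real \<times> real) \<Rightarrow> real \<Rightarrow> real" where
  "kappa2 G t = deriv (crv2 G 0) t / deriv (crv1 G 0) t"

definition kappa3 :: "(real \<Rightarrow> real \<Rightarrow> real \<times> real) \<Rightarrow> (real \<Rightarrow> real) \<Rightarrow> real \<Rightarrow> real" where
  "kappa3 G f t = deriv f t / deriv (crv1 G 0) t"

definition frak_K :: "(real \<Rightarrow> real \<Rightarrow> real \<times> real) \<Rightarrow> (real \<Rightarrow> real) \<Rightarrow> real \<Rightarrow> real" where
  "frak_K G f t = deriv (kappa3 G f) t / deriv (kappa2 G) t"

definition C2_real :: "(real \<Rightarrow> real) \<Rightarrow> bool" where
  "C2_real f \<longleftrightarrow> (\<forall>t. f differentiable (at t)) \<and> (\<forall>t. deriv f differentiable (at t)) \<and>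
     continuous_on UNIV (deriv (deriv f))"

definition piecewise_monotone :: "(real \<Rightarrow> real) \<Rightarrow> bool" where
  "piecewise_monotone h \<longleftrightarrow>
     (\<exists>\<J>. finite \<J> \<and> \<Union>\<J> = UNIV \<and>
        (\<forall>J\<in>\<J>. is_interval J \<and> (mono_on J h \<or> antimono_on J h)))"

definition regular_function :: "(real \<Rightarrow> real \<Rightarrow> real \<times> real) \<Rightarrow> (real \<Rightarrow> real) \<Rightarrow> bool" where
  "regular_function G f \<longleftrightarrow> C2_real f \<and> piecewise_monotone (frak_K G f)"


section \<open>The Bellman function\<close>

definition nondeg_interval :: "real set \<Rightarrow> bool" where
  "nondeg_interval J \<longleftrightarrow> is_interval J \<and> bounded J \<and> interior J \<noteq> {}"

definition average :: "real set \<Rightarrow> (real \<Rightarrow> real \<times> real) \<Rightarrow> real \<times> real" where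
  "average J \<phi> = (1 / measure lebesgue J) *\<^sub>R set_lebesgue_integral lebesgue J \<phi>"

definition test_class ::
    "(real \<Rightarrow> real \<Rightarrow> real \<times> real) \<Rightarrow> real \<Rightarrow> real set \<Rightarrow> (real \<Rightarrow> real \<times> real) set" where
  "test_class G e I = {\<phi>. set_integrable lebesgue I \<phi> \<and> \<phi> ` I \<subseteq> fixed_boundary G \<and>
     (\<forall>J. J \<subseteq> I \<longrightarrow> nondeg_interval J \<longrightarrow> average J \<phi> \<in> Omega G e)}"

text \<open>The boundary values of \<open>f\<close> carried over to the curve, \<open>boundary_fun G f (G t 0) = f t\<close>.\<close>

definition boundary_fun :: "(real \<Rightarrow> real \<Rightarrow> real \<times> real) \<Rightarrow> (real \<Rightarrow> real) \<Rightarrow> real \<times> real \<Rightarrow> real" where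
  "boundary_fun G f x = f (inv (\<lambda>t. G t 0) x)"

text \<open>Averages with values in \<open>[-\<infinity>, +\<infinity>]\<close>: they make sense unless both the positive and
  the negative part have infinite integral.\<close>

definition pos_integral :: "real set \<Rightarrow> (real \<Rightarrow> real) \<Rightarrow> ennreal" where
  "pos_integral I h = (\<integral>\<^sup>+s\<in>I. ennreal (h s) \<partial>lebesgue)"

definition has_ext_average :: "real set \<Rightarrow> (real \<Rightarrow> real) \<Rightarrow> bool" where
  "has_ext_average I h \<longleftrightarrow> pos_integral I h < \<infinity> \<or> pos_integral I (\<lambda>s. - h s) < \<infinity>"

definition ext_average :: "real set \<Rightarrow> (real \<Rightarrow> real) \<Rightarrow> ereal" where
  "ext_average I h =
     (enn2ereal (pos_integral I h) - enn2ereal (pos_integral I (\<lambda>s. - h s)))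
       / ereal (measure lebesgue I)"

definition bellman ::
    "(real \<Rightarrow> real \<Rightarrow> real \<times> real) \<Rightarrow> real \<Rightarrow> real set \<Rightarrow> (real \<Rightarrow> real) \<Rightarrow> real \<times> real \<Rightarrow> ereal" where
  "bellman G e I f x =
     Sup {ext_average I (\<lambda>s. boundary_fun G f (\<phi> s)) | \<phi>.
       \<phi> \<in> test_class G e I \<and> average I \<phi> = x \<and>
       has_ext_average I (\<lambda>s. boundary_fun G f (\<phi> s))}"

end

theory Submission
  imports Defs
begin

text \<open>
  For every point \<open>z\<close> of the domain off the fixed boundary there are test functions with average \<open>z\<close> along
  which the averages of \<open>f\<close> tend to infinity.

  Let \<open>g\<close> be the fixed curve, let \<open>w(\<tau>)\<close> be the tangency point of the right tangent from \<open>g(\<tau>)\<close>, and let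
  \<open>E(\<tau>) = exp (- \<integral>\<^sub>\<tau>\<^sup>v \<lambda>)\<close>. From \<open>w' = \<lambda> (g - w)\<close> one gets \<open>(E w)' = E' g\<close>. Hence, if a function
  has the mean \<open>w(\<tau>)\<close> over \<open>[0, E(\<tau>)]\<close> and continues with the value \<open>g(x)\<close> at time \<open>E(x)\<close>, then its mean over
  \<open>[0, E(x)]\<close> runs through the points \<open>w(x)\<close> of the free boundary. Once \<open>x = t\<close> is reached, the function
  stays at \<open>g(t)\<close>, and the mean moves along the tangent segment from \<open>w(t)\<close> towards \<open>g(t)\<close>; these segments
  cover the domain (\<open>band_point_on_right_tangent\<close>). The start on \<open>[0, E(\<tau>)]\<close> takes just two values, the two
  intersections \<open>g(b)\<close> and \<open>g(\<tau>)\<close>, \<open>b < \<tau>\<close>, of the tangent line through \<open>w(\<tau>)\<close> with the fixed curve. The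
  means over all subintervals stay in the domain: such a mean lies below the tangent line that carries
  the mean up to the right end of the subinterval (\<open>mean_in_band\<close>).

  The start carries the whole effect. Near minus infinity the slope of the fixed curve tends to minus
  infinity (\<open>slope_unbounded_below\<close>), and together with \<open>\<KK> \<rightarrow> \<infinity>\<close> this gives
  \<open>f(b) - f(\<tau>) \<ge> N (g\<^sub>2(b) - g\<^sub>2(\<tau>))\<close> for every \<open>N\<close> and all \<open>b \<le> \<tau>\<close> far enough to the left
  (\<open>f_dominates_Y\<close>). So the integral of \<open>f\<close> over the start exceeds \<open>E(\<tau>) f(\<tau>)\<close> by at least
  \<open>N E(\<tau>) (w\<^sub>2(\<tau>) - g\<^sub>2(\<tau>)) = - N \<vartheta>\<^sub>2(\<tau>)\<close>, whose limit as \<open>\<tau> \<rightarrow> - \<infinity>\<close> is a positive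
  multiple of \<open>N\<close>, because the limit of \<open>\<vartheta>\<^sub>2\<close> is negative. On the remaining part of the interval \<open>f\<close> is bounded below.

  The geometry is carried out for an abstract pair of convex curves. That the domain, which is a union of
  curvilinear triangles, is the whole band between the two curves is \<open>Omega_eq_band\<close>.
\<close>

section \<open>Strictly convex parametrised curves\<close>

definition tangent_height ::
    "(real \<Rightarrow> real) \<Rightarrow> (real \<Rightarrow> real) \<Rightarrow> (real \<Rightarrow> real) \<Rightarrow> real \<Rightarrow> real \<Rightarrow> real" where
  "tangent_height x y m s z = y s + m s * (z - x s)"

text \<open>Curves are described by their parametrisation throughout and not as graphs, which
  would require inverse functions. The slope \<open>m\<close> of the tangent is a function of the parameter as well, and convexity
  is \<open>m' > 0\<close>.\<close>

locale convex_param =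
  fixes x y m x' m' :: "real \<Rightarrow> real"
  assumes x_deriv: "(x has_real_derivative x' s) (at s)"
    and x'_pos: "x' s > 0"
    and y_deriv: "(y has_real_derivative m s * x' s) (at s)"
    and m_deriv: "(m has_real_derivative m' s) (at s)"
    and m'_pos: "m' s > 0"
begin

lemma x_mono: "strict_mono x"
  by (rule strict_monoI) (meson DERIV_pos_imp_increasing x_deriv x'_pos)

lemma m_mono: "strict_mono m"
  by (rule strict_monoI) (meson DERIV_pos_imp_increasing m_deriv m'_pos)

lemma x_less_iff: "x s < x t \<longleftrightarrow> s < t" and x_le_iff: "x s \<le> x t \<longleftrightarrow> s \<le> t"
  and x_eq_iff: "x s = x t \<longleftrightarrow> s = t"
  using x_mono by (auto simp: strict_mono_less strict_mono_less_eq strict_mono_eq)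

lemma x_isCont: "isCont x s" and y_isCont: "isCont y s" and m_isCont: "isCont m s"
  using x_deriv y_deriv m_deriv DERIV_isCont by blast+

lemma x_cont: "continuous_on A x" and y_cont: "continuous_on A y"
  using x_isCont y_isCont m_isCont by (auto intro: continuous_at_imp_continuous_on)

lemma range_x_between:
  assumes "x a \<le> z" "z \<le> x b"
  obtains t where "x t = z" "a \<le> t" "t \<le> b"
proof -
  have "a \<le> b" using assms x_le_iff by (meson order_trans)
  then show ?thesis using IVT'[of x a z b] assms x_cont that by blast
qed

abbreviation "L \<equiv> tangent_height x y m"

lemma L_self [simp]: "L s (x s) = y s"
  by (simp add: tangent_height_def)

text \<open>The two terms with \<open>m s * x' s\<close> cancel: a tangent line rotates about its tangency point.\<close>

lemma L_deriv: "((\<lambda>s. L s z) has_real_derivative m' s * (z - x s)) (at s)"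
  unfolding tangent_height_def
  by (auto intro!: derivative_eq_intros x_deriv y_deriv m_deriv)

lemma L_cont: "continuous_on A (\<lambda>s. L s z)"
  by (rule continuous_at_imp_continuous_on) (blast intro: DERIV_isCont L_deriv)

lemma L_less_right:
  assumes "s < t" "x t \<le> z"
  shows "L s z < L t z"
proof (rule DERIV_pos_imp_increasing_open[OF assms(1) _ L_cont])
  fix u assume "s < u" "u < t"
  then have "x u < z" using assms x_less_iff by (meson less_le_trans)
  then show "\<exists>d. ((\<lambda>s. L s z) has_real_derivative d) (at u) \<and> 0 < d"
    using L_deriv m'_pos by (meson diff_gt_0_iff_gt mult_pos_pos)
qed

lemma L_less_left:
  assumes "s < t" "z \<le> x s"
  shows "L t z < L s z"
proof (rule DERIV_neg_imp_decreasing_open[OF assms(1) _ L_cont])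
  fix u assume "s < u" "u < t"
  then have "z < x u" using assms x_less_iff by (meson le_less_trans)
  then show "\<exists>d. ((\<lambda>s. L s z) has_real_derivative d) (at u) \<and> d < 0"
    using L_deriv m'_pos by (meson diff_less_0_iff_less mult_pos_neg)
qed

lemma L_less: "s \<noteq> t \<Longrightarrow> L s (x t) < y t"
  using L_less_right[of s t "x t"] L_less_left[of t s "x t"] by (cases "s < t") auto

lemma L_le: "L s (x t) \<le> y t"
  using L_less[of s t] by (cases "s = t") auto

text \<open>The tangents at the two ends of a chord lie below the curve. This bounds the slope of the chord
  by the slopes at its ends, and the ends of the curve leave the line of the chord upwards.\<close>

context
  fixes b t c \<mu> :: real
  assumes chord: "b < t" "y b = c + \<mu> * x b" "y t = c + \<mu> * x t"
begin

lemma chord_slope_right: "\<mu> < m t"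
proof -
  have "0 < (m t - \<mu>) * (x t - x b)"
    using L_less[of t b] chord by (simp add: tangent_height_def algebra_simps)
  then show ?thesis using chord(1) x_less_iff[of b t] by (simp add: zero_less_mult_iff)
qed

lemma chord_slope_left: "m b < \<mu>"
proof -
  have "0 < (\<mu> - m b) * (x t - x b)"
    using L_less[of b t] chord by (simp add: tangent_height_def algebra_simps)
  then show ?thesis using chord(1) x_less_iff[of b t] by (simp add: zero_less_mult_iff)
qed

lemma chord_right: "t < u \<Longrightarrow> c + \<mu> * x u < y u"
proof -
  assume "t < u"
  then have "0 < (m t - \<mu>) * (x u - x t)"
    using chord_slope_right x_less_iff[of t u] by simp
  then show ?thesis
    using L_le[of t u] chord by (simp add: tangent_height_def algebra_simps)
qed

lemma chord_left: "u < b \<Longrightarrow> c + \<mu> * x u < y u"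
proof -
  assume "u < b"
  then have "0 < (\<mu> - m b) * (x b - x u)"
    using chord_slope_left x_less_iff[of u b] by simp
  then show ?thesis
    using L_le[of b u] chord by (simp add: tangent_height_def algebra_simps)
qed

end

end

section \<open>The band between two convex curves\<close>

text \<open>The free curve \<open>(p, q)\<close> lies above the fixed curve \<open>(X, Y)\<close>, over the same interval. Through every
  point of the fixed curve there are two tangents of the free curve, and such a tangent meets the fixed
  curve a second time. In the assumptions \<open>s\<close> and \<open>t\<close> are parameters of the free and of the fixed
  curve respectively.\<close>

locale tangent_band =
  free: convex_param p q m p' m' + fixed: convex_param X Y k X' k'
  for p q m p' m' X Y k X' k' :: "real \<Rightarrow> real" +
  assumes p'_cont: "isCont p' s" and m'_cont: "isCont m' s" and X'_cont: "isCont X' t"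
    and fixed_below_free: "p s = X t \<Longrightarrow> Y t < q s"
    and p_in_range_X: "\<exists>t. X t = p s"
    and two_tangency_params:
      "\<exists>s1 s2. s1 < s2 \<and> tangent_height p q m s1 (X t) = Y t \<and> tangent_height p q m s2 (X t) = Y t"
    and tangent_meets_again:
      "tangent_height p q m s (X t) = Y t \<Longrightarrow> \<exists>b. b \<noteq> t \<and> tangent_height p q m s (X b) = Y b"
begin

text \<open>The height of the tangent line over a given abscissa increases with the tangency parameter as long
  as the tangency point is to the left of that abscissa, and decreases afterwards. Hence it takes the
  value \<open>Y t\<close> at most once on either side.\<close>

lemma tangency_points_straddle:
  assumes "s1 < s2" "free.L s1 (X t) = Y t" "free.L s2 (X t) = Y t"
  shows "p s1 < X t" "X t < p s2"
  using free.L_less_right[of s1 s2 "X t"] free.L_less_left[of s1 s2 "X t"] assms by force+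

lemma X_in_range_p:
  obtains s where "p s = X t"
proof -
  obtain s1 s2 where "s1 < s2" "free.L s1 (X t) = Y t" "free.L s2 (X t) = Y t"
    using two_tangency_params by blast
  from tangency_points_straddle[OF this] show ?thesis
    using free.range_x_between[of s1 "X t" s2] that by (meson less_imp_le)
qed

text \<open>The parameter of the tangency point to the left of \<open>(X t, Y t)\<close>. The segment from this tangency point
  to \<open>(X t, Y t)\<close> is the tangent segment with index R; see \<open>s_R_eq\<close> below.\<close>

definition r :: "real \<Rightarrow> real" where
  "r t = (THE s. p s < X t \<and> free.L s (X t) = Y t)"

lemma right_tangency_unique:
  assumes "p s < X t" "free.L s (X t) = Y t" "p s' < X t" "free.L s' (X t) = Y t"
  shows "s = s'"
  using tangency_points_straddle(2)[of s s' t] tangency_points_straddle(2)[of s' s t] assms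
  by (meson linorder_cases order_less_asym)

lemma r: "p (r t) < X t" "free.L (r t) (X t) = Y t"
proof -
  obtain s1 s2 where "s1 < s2" "free.L s1 (X t) = Y t" "free.L s2 (X t) = Y t"
    using two_tangency_params by blast
  then have "\<exists>!s. p s < X t \<and> free.L s (X t) = Y t"
    using tangency_points_straddle right_tangency_unique by metis
  from theI'[OF this] show "p (r t) < X t" "free.L (r t) (X t) = Y t"
    unfolding r_def by auto
qed

lemma r_eqI: "p s < X t \<Longrightarrow> free.L s (X t) = Y t \<Longrightarrow> r t = s"
  using r right_tangency_unique by blast

lemma q_r: "q (r t) + m (r t) * (X t - p (r t)) = Y t"
  using r(2)[of t] by (simp add: tangent_height_def)

lemma tangency_params_eq:
  obtains l where "X t < p l" "{s. free.L s (X t) = Y t} = {r t, l}" "r t < l"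
proof -
  obtain s1 s2 where s: "s1 < s2" "free.L s1 (X t) = Y t" "free.L s2 (X t) = Y t"
    using two_tangency_params by blast
  note S = tangency_points_straddle[OF this]
  have "r t = s1" using S s r_eqI by blast
  moreover have "s = s1 \<or> s = s2" if "free.L s (X t) = Y t" for s
    using that s S tangency_points_straddle[of s s1 t] tangency_points_straddle[of s1 s t]
       tangency_points_straddle[of s s2 t] tangency_points_straddle[of s2 s t]
    by (meson linorder_cases order_less_asym)
  ultimately show ?thesis using that[of s2] s S by blast
qed

lemma tangent_as_line: "free.L s z = (q s - m s * p s) + m s * z"
  by (simp add: tangent_height_def algebra_simps)

text \<open>The tangency point is on the line and above the fixed curve. A line through two points of a
  strictly convex curve is above the curve only between these points, so the tangency point separates
  the two intersections.\<close>

lemma other_end: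
  assumes "free.L s (X t) = Y t"
  obtains b where "free.L s (X b) = Y b" "p s < X t \<Longrightarrow> X b < p s" "X t < p s \<Longrightarrow> p s < X b"
proof -
  obtain b where b: "b \<noteq> t" "free.L s (X b) = Y b" using tangent_meets_again[OF assms] by blast
  obtain u where u: "X u = p s" using p_in_range_X by blast
  have lt: "Y u < free.L s (X u)" using fixed_below_free[of s u] u by simp
  let ?c = "q s - m s * p s"
  have eqs: "Y b = ?c + m s * X b" "Y t = ?c + m s * X t"
    using b assms by (auto simp: tangent_as_line)
  have lt': "Y u < ?c + m s * X u" using lt by (simp add: tangent_as_line)
  have "u \<noteq> b" "u \<noteq> t" using lt b assms by auto
  then have "(b < u \<and> u < t) \<or> (t < u \<and> u < b)"
    using fixed.chord_left[of b t ?c "m s" u] fixed.chord_left[of t b ?c "m s" u]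
      fixed.chord_right[of b t ?c "m s" u] fixed.chord_right[of t b ?c "m s" u] eqs lt' b(1)
    by (metis linorder_neqE_linordered_idom order_less_asym)
  then show ?thesis using that[OF b(2)] u fixed.x_less_iff by (metis order_less_asym)
qed

lemma left_end:
  obtains b where "X b < p (r t)" "b < t" "free.L (r t) (X b) = Y b"
  using other_end[OF r(2), of t] r(1) that fixed.x_less_iff by (metis order_less_trans)

lemma slope_r: "m (r t) < k t"
proof -
  obtain b where "X b < p (r t)" "b < t" "free.L (r t) (X b) = Y b" using left_end .
  then show ?thesis
    using fixed.chord_slope_right[of b t "q (r t) - m (r t) * p (r t)" "m (r t)"] r(2)
    by (simp add: tangent_as_line)
qed

text \<open>The root \<open>r t\<close> is trapped: the difference between tangent line and fixed curve is negative at
  \<open>r t - e\<close> and positive at some \<open>z\<close> slightly above \<open>r t\<close>, and both signs persist for parameters close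
  to \<open>t\<close>.\<close>

lemma isCont_r: "isCont r t"
proof -
  have "r \<midarrow>t\<rightarrow> r t"
  proof (rule LIM_I)
    fix e :: real assume "e > 0"
    obtain z where z: "r t < z" "z < r t + e" "p z < X t"
    proof -
      have "isCont p (r t)" by (rule free.x_isCont)
      then have "\<forall>\<^sub>F s in at (r t). p s < X t"
        using r(1) by (simp add: isCont_def order_tendsto_iff)
      then have "\<forall>\<^sub>F s in at_right (r t). p s < X t" 
        by (simp add: eventually_at_split)
      moreover have "\<forall>\<^sub>F s in at_right (r t). s \<in> {r t<..<r t + e}"
        using \<open>e > 0\<close> by (intro eventually_at_right_real) auto
      ultimately have "\<forall>\<^sub>F s in at_right (r t). p s < X t \<and> s \<in> {r t<..<r t + e}"
        by eventually_elim auto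
      from eventually_happens[OF this] show thesis using that by auto
    qed
    have lo: "free.L (r t - e) (X t) < Y t"
      using free.L_less_right[of "r t - e" "r t" "X t"] r[of t] \<open>e > 0\<close> by simp
    have hi: "Y t < free.L z (X t)"
      using free.L_less_right[of "r t" z "X t"] r[of t] z by simp
    have XY: "(X \<longlongrightarrow> X t) (at t)" "(Y \<longlongrightarrow> Y t) (at t)"
      using fixed.x_isCont fixed.y_isCont isCont_def by blast+
    have "((\<lambda>u. free.L s (X u) - Y u) \<longlongrightarrow> free.L s (X t) - Y t) (at t)" for s
      unfolding tangent_height_def by (intro tendsto_intros XY)
    then have "\<forall>\<^sub>F u in at t. free.L (r t - e) (X u) - Y u < 0"
         "\<forall>\<^sub>F u in at t. 0 < free.L z (X u) - Y u"
      using lo hi order_tendstoD by (metis diff_less_0_iff_less, metis diff_gt_0_iff_gt)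
    moreover have "\<forall>\<^sub>F u in at t. p z < X u"
      using z(3) XY(1) by (rule order_tendstoD(1)[rotated])
    ultimately have "\<forall>\<^sub>F u in at t. norm (r u - r t) < e"
    proof eventually_elim
      case (elim u)
      have "\<exists>s. r t - e \<le> s \<and> s \<le> z \<and> free.L s (X u) = Y u"
        using IVT'[OF _ _ _ free.L_cont, of "r t - e" "X u" "Y u" z] elim z(1) \<open>e > 0\<close> by auto
      then obtain s where s: "r t - e \<le> s" "s \<le> z" "free.L s (X u) = Y u" by blast
      then have "p s < X u" using elim(3) free.x_le_iff by (meson le_less_trans)
      then have "r u = s" using r_eqI s by blast
      moreover have "s \<noteq> r t - e" using elim(1) s(3) by auto
      ultimately show ?case using s z(2) by auto
    qed
    then show "\<exists>d>0. \<forall>u. u \<noteq> t \<and> norm (u - t) < d \<longrightarrow> norm (r u - r t) < e"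
      unfolding eventually_at dist_norm by auto
  qed
  then show ?thesis by (simp add: isCont_def)
qed

lemma cont_r: "continuous_on A r"
  using isCont_r continuous_at_imp_continuous_on by blast

lemma isCont_comp_r: "isCont h (r t) \<Longrightarrow> isCont (\<lambda>u. h (r u)) t"
  using isCont_o2[OF isCont_r] by blast

text \<open>Let \<open>u\<close> be the fixed parameter below the point with free parameter \<open>s\<close>. The tangent from \<open>u\<close> that
  goes to the right touches the free curve at \<open>l > s\<close> and ends at \<open>b\<close> with \<open>r b = l\<close>. Since
  \<open>r u < s < l\<close>, continuity of \<open>r\<close> gives the claim.\<close>

lemma r_surj:
  obtains t where "r t = s"
proof -
  obtain u where u: "X u = p s" using p_in_range_X by blast
  obtain l where l: "X u < p l" "{s. free.L s (X u) = Y u} = {r u, l}" "r u < l"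
    using tangency_params_eq .
  then have l2: "free.L l (X u) = Y u" by blast
  obtain b where b: "free.L l (X b) = Y b" "p l < X b" using other_end[OF l2] l(1) by blast
  have "r u < s" using r(1)[of u] u free.x_less_iff by simp
  moreover have "s < r b" using r_eqI[OF b(2,1)] l(1) u free.x_less_iff by simp
  moreover have "u \<le> b" using l(1) b fixed.x_less_iff by (meson less_imp_le less_trans)
  ultimately show thesis using IVT'[of r u s b, OF _ _ _ cont_r] that by force
qed

text \<open>Differentiating the equation \<open>L (r t) (X t) = Y t\<close> implicitly yields \<open>r'\<close>, and
  \<open>lam t = (p o r)' t / (X t - p (r t))\<close>. This is the function \<open>lambda_R\<close>; see \<open>lambda_R_eq\<close> below.\<close>

definition lam :: "real \<Rightarrow> real" where
  "lam t = (k t - m (r t)) * X' t * p' (r t) / (m' (r t) * (X t - p (r t))\<^sup>2)"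

lemma lam_pos: "lam t > 0"
  using slope_r[of t] fixed.x'_pos free.x'_pos free.m'_pos r(1)[of t] by (simp add: lam_def)

lemma isCont_lam: "isCont lam t"
proof -
  have "m' (r t) * (X t - p (r t))\<^sup>2 \<noteq> 0"
    using free.m'_pos[of "r t"] r(1)[of t] by simp
  then show ?thesis
    unfolding lam_def
    by (intro continuous_intros isCont_comp_r fixed.m_isCont free.m_isCont X'_cont p'_cont m'_cont
        fixed.x_isCont free.x_isCont)
qed

text \<open>The implicit function theorem in one variable: by the mean value theorem, the change of the height of
  the tangent line over \<open>X u\<close> is \<open>r u - r t\<close> times the partial derivative at an intermediate point
  \<open>\<xi> u\<close>, which tends to \<open>r t\<close> because \<open>r\<close> is continuous.\<close>

lemma r_deriv:
  "(r has_real_derivative (k t - m (r t)) * X' t / (m' (r t) * (X t - p (r t)))) (at t)"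
proof -
  define \<xi> where "\<xi> u = (SOME z. min (r t) (r u) \<le> z \<and> z \<le> max (r t) (r u) \<and>
      free.L (r u) (X u) - free.L (r t) (X u) = (r u - r t) * (m' z * (X u - p z)))" for u
  have "\<exists>z. min (r t) (r u) \<le> z \<and> z \<le> max (r t) (r u) \<and>
      free.L (r u) (X u) - free.L (r t) (X u) = (r u - r t) * (m' z * (X u - p z))" for u
  proof (cases "r u = r t")
    case False
    then have "min (r t) (r u) < max (r t) (r u)" by auto
    from MVT2[OF this free.L_deriv[of "X u"]] obtain z where
      "min (r t) (r u) < z" "z < max (r t) (r u)"
      "free.L (max (r t) (r u)) (X u) - free.L (min (r t) (r u)) (X u)
         = (max (r t) (r u) - min (r t) (r u)) * (m' z * (X u - p z))"
      by blast
    then show ?thesis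
      by (intro exI[of _ z]) (auto simp: max_def min_def algebra_simps split: if_splits)
  qed auto
  from someI_ex[OF this] have \<xi>: "min (r t) (r u) \<le> \<xi> u" "\<xi> u \<le> max (r t) (r u)"
      "Y u - free.L (r t) (X u) = (r u - r t) * (m' (\<xi> u) * (X u - p (\<xi> u)))" for u
    unfolding \<xi>_def[symmetric] using r(2)[of u] by metis+
  have rt: "(r \<longlongrightarrow> r t) (at t)" using isCont_r isCont_def by blast
  have "((\<lambda>u. min (r t) (r u)) \<longlongrightarrow> min (r t) (r t)) (at t)"
       "((\<lambda>u. max (r t) (r u)) \<longlongrightarrow> max (r t) (r t)) (at t)"
    by (intro tendsto_intros rt)+
  then have \<xi>_lim: "(\<xi> \<longlongrightarrow> r t) (at t)"
    using tendsto_sandwich[of "\<lambda>u. min (r t) (r u)" \<xi> "at t" "\<lambda>u. max (r t) (r u)"] \<xi>(1,2) by auto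
  have X: "(X \<longlongrightarrow> X t) (at t)" using fixed.x_isCont isCont_def by blast
  have den: "((\<lambda>u. m' (\<xi> u) * (X u - p (\<xi> u))) \<longlongrightarrow> m' (r t) * (X t - p (r t))) (at t)"
    by (intro tendsto_intros X isCont_tendsto_compose[OF m'_cont \<xi>_lim]
        isCont_tendsto_compose[OF free.x_isCont \<xi>_lim])
  have den0: "m' (r t) * (X t - p (r t)) > 0" using free.m'_pos[of "r t"] r(1)[of t] by simp
  have "((\<lambda>u. Y u - free.L (r t) (X u)) has_real_derivative k t * X' t - m (r t) * X' t) (at t)"
    unfolding tangent_height_def
    by (auto intro!: derivative_eq_intros fixed.x_deriv fixed.y_deriv)
  then have num: "((\<lambda>u. (Y u - free.L (r t) (X u)) / (u - t)) \<longlongrightarrow> (k t - m (r t)) * X' t) (at t)"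
    using r(2)[of t] by (simp add: has_field_derivative_iff left_diff_distrib)
  have "\<forall>\<^sub>F u in at t. (Y u - free.L (r t) (X u)) / (u - t) / (m' (\<xi> u) * (X u - p (\<xi> u)))
      = (r u - r t) / (u - t)"
    using order_tendstoD(1)[OF den den0]
    by eventually_elim (auto simp: \<xi>(3))
  moreover have "((\<lambda>u. (Y u - free.L (r t) (X u)) / (u - t) / (m' (\<xi> u) * (X u - p (\<xi> u))))
      \<longlongrightarrow> (k t - m (r t)) * X' t / (m' (r t) * (X t - p (r t)))) (at t)"
    by (intro tendsto_divide num den) (use den0 in linarith)
  ultimately show ?thesis
    unfolding has_field_derivative_iff by (rule tendsto_cong[THEN iffD1])
qed

lemma lam_alt:
  "lam t * (X t - p (r t)) = p' (r t) * ((k t - m (r t)) * X' t / (m' (r t) * (X t - p (r t))))"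
  using r(1)[of t] by (simp add: lam_def power2_eq_square)

lemma p_r_deriv: "((\<lambda>u. p (r u)) has_real_derivative lam t * (X t - p (r t))) (at t)"
  using DERIV_chain2[OF free.x_deriv r_deriv, of t] by (simp add: lam_alt)

lemma q_r_deriv: "((\<lambda>u. q (r u)) has_real_derivative lam t * (Y t - q (r t))) (at t)"
proof -
  have "Y t - q (r t) = (X t - p (r t)) * m (r t)"
    using q_r[of t] by (simp add: algebra_simps)
  then show ?thesis
    using DERIV_chain2[OF free.y_deriv r_deriv, of t] lam_alt[of t] by (simp add: mult_ac)
qed

lemma r_mono: "strict_mono r"
proof -
  have "(k t - m (r t)) * X' t / (m' (r t) * (X t - p (r t))) > 0" for t
    using slope_r[of t] fixed.x'_pos[of t] free.m'_pos[of "r t"] r(1)[of t] by simp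
  then have "\<exists>d. (r has_real_derivative d) (at t) \<and> 0 < d" for t
    using r_deriv by blast
  then show ?thesis
    by (intro strict_monoI DERIV_pos_imp_increasing[where f = r])
qed

end

context tangent_band
begin

definition band :: "(real \<times> real) set" where
  "band = {(z1, z2) | z1 z2. \<exists>v s. X v = z1 \<and> p s = z1 \<and> Y v \<le> z2 \<and> z2 \<le> q s}"

lemma bandI: "X v = z1 \<Longrightarrow> p s = z1 \<Longrightarrow> Y v \<le> z2 \<Longrightarrow> z2 \<le> q s \<Longrightarrow> (z1, z2) \<in> band"
  by (auto simp: band_def)

end

section \<open>The test functions\<close>

lemma has_real_derivative_local:
  fixes F :: "real \<Rightarrow> real"
  assumes "(F has_real_derivative d) (at s)" "s \<in> {a<..<c}" "\<And>v. v \<in> {a<..<c} \<Longrightarrow> F v = H v"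
  shows "(H has_vector_derivative d) (at s)"
  using assms(1)[THEN has_field_derivative_transform_within_open, of "{a<..<c}"] assms(2,3)
  by (simp add: has_real_derivative_iff_has_vector_derivative)

text \<open>The construction of one test function \<open>s \<mapsto> (X (\<psi> s), Y (\<psi> s))\<close> on \<open>[0, T]\<close>. The integrating factor \<open>E\<close>
  of \<open>lam\<close> serves as the time scale: at time \<open>E x\<close> with \<open>\<tau> \<le> x \<le> t\<close> the function visits the point with
  parameter \<open>x\<close>, and its mean over \<open>[0, E x]\<close> is the tangency point with parameter \<open>r x\<close>. The parameter
  \<open>b\<close> belongs to the left end of the tangent line through the point with parameter \<open>\<tau>\<close>.\<close>

locale band_test = tangent_band +
  fixes E :: "real \<Rightarrow> real" and b \<tau> t T :: real
  assumes E_deriv: "(E has_real_derivative lam s * E s) (at s)"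
    and E_pos: "0 < E s"
    and tau_le: "\<tau> \<le> t"
    and b_left: "X b < p (r \<tau>)"
    and b_line: "tangent_height p q m (r \<tau>) (X b) = Y b"
    and T_ge: "E t \<le> T"
begin

definition u :: "real \<Rightarrow> real" where "u = inv E"

text \<open>The switching time that makes the mean over \<open>[0, E \<tau>]\<close> of the values at \<open>b\<close> (before \<open>T0\<close>) and at
  \<open>\<tau>\<close> (after \<open>T0\<close>) equal to the tangency point with parameter \<open>r \<tau>\<close>.\<close>

definition T0 :: real where "T0 = (X \<tau> - p (r \<tau>)) / (X \<tau> - X b) * E \<tau>"

definition \<psi> :: "real \<Rightarrow> real" where
  "\<psi> s = (if s \<le> T0 then b else if s \<le> E \<tau> then \<tau> else if s \<le> E t then u s else t)"

text \<open>The indefinite integral of \<open>Z o \<psi>\<close>, used for \<open>Z = X\<close> with \<open>w = p o r\<close> and for \<open>Z = Y\<close> with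
  \<open>w = q o r\<close>.\<close>

definition prim :: "(real \<Rightarrow> real) \<Rightarrow> (real \<Rightarrow> real) \<Rightarrow> real \<Rightarrow> real" where
  "prim Z w s = (if s \<le> T0 then s * Z b else if s \<le> E \<tau> then T0 * Z b + (s - T0) * Z \<tau>
     else if s \<le> E t then s * w (u s) else E t * w t + (s - E t) * Z t)"

abbreviation "PX \<equiv> prim X (\<lambda>s. p (r s))"
abbreviation "PY \<equiv> prim Y (\<lambda>s. q (r s))"

lemma E_mono: "strict_mono E"
proof -
  have "\<exists>d. (E has_real_derivative d) (at s) \<and> 0 < d" for s
    using E_deriv lam_pos E_pos mult_pos_pos by blast
  then show ?thesis by (intro strict_monoI DERIV_pos_imp_increasing[where f = E])
qed

lemma E_le_iff: "E a \<le> E c \<longleftrightarrow> a \<le> c"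
  using E_mono by (rule strict_mono_less_eq)

lemma u_E [simp]: "u (E s) = s"
  unfolding u_def using E_mono by (simp add: strict_mono_imp_inj_on)

lemma E_isCont: "isCont E s"
  using E_deriv DERIV_isCont by blast

lemma E_u_between:
  assumes "E a \<le> s" "s \<le> E c"
  shows "E (u s) = s" "a \<le> u s" "u s \<le> c"
proof -
  have "a \<le> c" using assms E_le_iff by (meson order_trans)
  then obtain z where "E z = s" "a \<le> z" "z \<le> c"
    using IVT'[of E a s c] assms E_isCont by (meson continuous_at_imp_continuous_on)
  then show "E (u s) = s" "a \<le> u s" "u s \<le> c" by auto
qed

lemma u_deriv: "(u has_real_derivative inverse (lam x * E x)) (at (E x))"
proof (rule DERIV_inverse_function[where f = E and a = "E (x - 1)" and b = "E (x + 1)"])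
  show "(E has_real_derivative lam x * E x) (at (u (E x)))" using E_deriv by simp
  show "lam x * E x \<noteq> 0" using lam_pos[of x] E_pos[of x] by simp
  show "E (x - 1) < E x" "E x < E (x + 1)" using E_mono by (simp_all add: strict_mono_less)
  show "E (u y) = y" if "E (x - 1) < y" "y < E (x + 1)" for y
    using that E_u_between(1)[of "x - 1" y "x + 1"] by simp
  show "isCont u (E x)"
    using isCont_inverse_function2[of "x - 1" x "x + 1" u E] E_isCont by simp
qed

text \<open>The reason is the differential equation \<open>w' = lam (Z - w)\<close> in the form
  \<open>(E w)' = lam E Z\<close>, with \<open>s = E x\<close> taken as the independent variable.\<close>

lemma mid_deriv:
  assumes w: "\<And>x. (w has_real_derivative lam x * (Z x - w x)) (at x)"
    and s: "E \<tau> \<le> s" "s \<le> E t"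
  shows "((\<lambda>s. s * w (u s)) has_real_derivative Z (u s)) (at s)"
proof -
  obtain x where x: "s = E x" using E_u_between[OF s] by metis
  have "((\<lambda>s. w (u s)) has_real_derivative lam x * (Z x - w x) * inverse (lam x * E x)) (at (E x))"
    using DERIV_chain2[of w _ u "E x"] w[of x] u_deriv[of x] by simp
  then have "((\<lambda>s. s * w (u s)) has_real_derivative
      1 * w (u (E x)) + lam x * (Z x - w x) * inverse (lam x * E x) * E x) (at (E x))"
    by (rule DERIV_mult[OF DERIV_ident])
  moreover have "1 * w (u (E x)) + lam x * (Z x - w x) * inverse (lam x * E x) * E x = Z (u (E x))"
    using lam_pos[of x] E_pos[of x] by (simp add: field_simps)
  ultimately show ?thesis unfolding x by simp
qed

lemma b_less: "X b < X \<tau>" "b < \<tau>"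
proof -
  show "X b < X \<tau>" using b_left r(1)[of \<tau>] by simp
  then show "b < \<tau>" using fixed.x_less_iff by blast
qed

lemma T0_pos: "0 < T0" and T0_less: "T0 < E \<tau>" and E_le: "E \<tau> \<le> E t"
  using E_pos[of \<tau>] b_left r(1)[of \<tau>] tau_le E_le_iff
  by (simp_all add: T0_def field_simps)

lemma join_X: "E \<tau> * p (r \<tau>) = T0 * X b + (E \<tau> - T0) * X \<tau>"
proof -
  have "T0 * (X \<tau> - X b) = (X \<tau> - p (r \<tau>)) * E \<tau>"
    using b_less by (simp add: T0_def)
  then show ?thesis by (simp add: algebra_simps)
qed

lemma join_Y: "E \<tau> * q (r \<tau>) = T0 * Y b + (E \<tau> - T0) * Y \<tau>"
proof -
  have b: "Y b = q (r \<tau>) + m (r \<tau>) * (X b - p (r \<tau>))"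
    using b_line by (simp add: tangent_height_def)
  have "T0 * Y b + (E \<tau> - T0) * Y \<tau> = E \<tau> * q (r \<tau>)
      + m (r \<tau>) * (T0 * X b + (E \<tau> - T0) * X \<tau> - E \<tau> * p (r \<tau>))"
    unfolding b q_r[of \<tau>, symmetric] by (simp add: algebra_simps)
  then show ?thesis by (simp add: join_X)
qed

lemma prim_integral:
  assumes w: "\<And>x. (w has_real_derivative lam x * (Z x - w x)) (at x)"
    and join: "E \<tau> * w \<tau> = T0 * Z b + (E \<tau> - T0) * Z \<tau>"
    and "a \<le> c"
  shows "((\<lambda>s. Z (\<psi> s)) has_integral (prim Z w c - prim Z w a)) {a..c}"
proof (rule fundamental_theorem_of_calculus_interior_strong[where S = "{T0, E \<tau>, E t}"])
  note T = T0_less E_le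
  have mid: "continuous_on {E \<tau>..E t} (\<lambda>s. s * w (u s))"
    by (rule DERIV_continuous_on) (auto intro: mid_deriv[OF w, THEN has_field_derivative_at_within])
  have c3: "continuous_on {s. E \<tau> \<le> s}
      (\<lambda>s. if s \<le> E t then s * w (u s) else E t * w t + (s - E t) * Z t)"
    by (rule continuous_on_cases_le)
      (auto intro!: continuous_intros continuous_on_subset[OF mid])
  have c2: "continuous_on {s. T0 \<le> s} (\<lambda>s. if s \<le> E \<tau> then T0 * Z b + (s - T0) * Z \<tau>
      else if s \<le> E t then s * w (u s) else E t * w t + (s - E t) * Z t)"
    by (rule continuous_on_cases_le)
      (use T join in \<open>auto intro!: continuous_intros continuous_on_subset[OF c3]\<close>)
  have "continuous_on UNIV (prim Z w)"
    unfolding prim_def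
    by (rule continuous_on_cases_le)
      (use T in \<open>auto intro!: continuous_intros continuous_on_subset[OF c2]\<close>)
  then show "continuous_on {a..c} (prim Z w)" by (rule continuous_on_subset) simp
  fix s assume "s \<in> {a<..<c} - {T0, E \<tau>, E t}"
  then consider "s < T0" | "T0 < s" "s < E \<tau>" | "E \<tau> < s" "s < E t" | "E t < s" by force
  then show "(prim Z w has_vector_derivative Z (\<psi> s)) (at s)"
  proof cases
    case 1
    have "((\<lambda>s. s * Z b) has_real_derivative Z (\<psi> s)) (at s)"
      using 1 by (auto simp: \<psi>_def intro!: derivative_eq_intros)
    from this show ?thesis
      by (rule has_real_derivative_local[where a = "s - 1" and c = T0]) (use 1 in \<open>auto simp: prim_def\<close>)
  next
    case 2
    have "((\<lambda>s. T0 * Z b + (s - T0) * Z \<tau>) has_real_derivative Z (\<psi> s)) (at s)"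
      using 2 by (auto simp: \<psi>_def intro!: derivative_eq_intros)
    from this show ?thesis
      by (rule has_real_derivative_local[where a = T0 and c = "E \<tau>"]) (use 2 in \<open>auto simp: prim_def\<close>)
  next
    case 3
    have "((\<lambda>s. s * w (u s)) has_real_derivative Z (\<psi> s)) (at s)"
      using mid_deriv[OF w, of s] 3 T by (simp add: \<psi>_def)
    from this show ?thesis
      by (rule has_real_derivative_local[where a = "E \<tau>" and c = "E t"])
        (use 3 T in \<open>auto simp: prim_def\<close>)
  next
    case 4
    have "((\<lambda>s. E t * w t + (s - E t) * Z t) has_real_derivative Z (\<psi> s)) (at s)"
      using 4 T by (auto simp: \<psi>_def intro!: derivative_eq_intros)
    from this show ?thesis
      by (rule has_real_derivative_local[where a = "E t" and c = "s + 1"])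
        (use 4 T in \<open>auto simp: prim_def\<close>)
  qed
qed (use assms in auto)

lemma integral_X: "a \<le> c \<Longrightarrow> ((\<lambda>s. X (\<psi> s)) has_integral (PX c - PX a)) {a..c}"
  by (rule prim_integral[OF p_r_deriv join_X])

lemma integral_Y: "a \<le> c \<Longrightarrow> ((\<lambda>s. Y (\<psi> s)) has_integral (PY c - PY a)) {a..c}"
  by (rule prim_integral[OF q_r_deriv join_Y])

lemma prim_0: "prim Z w 0 = 0"
  using T0_pos by (simp add: prim_def)

lemma prim_tau: "E \<tau> * w \<tau> = T0 * Z b + (E \<tau> - T0) * Z \<tau> \<Longrightarrow> prim Z w (E \<tau>) = E \<tau> * w \<tau>"
  using T0_less by (simp add: prim_def)

lemma prim_T:
  assumes join: "E \<tau> * w \<tau> = T0 * Z b + (E \<tau> - T0) * Z \<tau>"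
  shows "prim Z w T = E t * w t + (T - E t) * Z t"
proof (cases "T \<le> E \<tau>")
  case True
  then have "E \<tau> = E t" "T = E t" using E_le T_ge by auto
  then have "\<tau> = t" using E_mono by (metis u_E)
  then show ?thesis using prim_tau[of w Z, OF join] \<open>T = E t\<close> by simp
next
  case False
  then show ?thesis using T_ge T0_less by (auto simp: prim_def)
qed

lemma psi_cases:
  "\<psi> s = b \<and> s \<le> T0 \<or> \<psi> s = \<tau> \<and> T0 < s \<and> s \<le> E \<tau>
    \<or> E \<tau> < s \<and> s \<le> E t \<and> E (\<psi> s) = s \<and> \<tau> \<le> \<psi> s \<and> \<psi> s \<le> t \<or> E t < s \<and> \<psi> s = t"
  using E_u_between[of \<tau> s t] E_le T0_less by (auto simp: \<psi>_def)

lemma psi_bounds: "b \<le> \<psi> s" "\<psi> s \<le> t" "E \<tau> < s \<Longrightarrow> \<tau> \<le> \<psi> s"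
  using psi_cases[of s] b_less tau_le T0_less by auto

lemma psi_mono: "mono \<psi>"
proof (rule monoI)
  fix s s' :: real assume "s \<le> s'"
  then show "\<psi> s \<le> \<psi> s'"
    using psi_cases[of s] psi_cases[of s'] b_less tau_le T0_less E_le E_le_iff[of "\<psi> s" "\<psi> s'"] by auto
qed

text \<open>The parameter of the tangent line on which the mean over \<open>[0, s]\<close> lies.\<close>

definition \<sigma> :: "real \<Rightarrow> real" where
  "\<sigma> s = (if s \<le> E \<tau> then r \<tau> else if s \<le> E t then r (u s) else r t)"

lemma sigma_mono: "s \<le> s' \<Longrightarrow> \<sigma> s \<le> \<sigma> s'"
  using E_u_between[of \<tau> s t] E_u_between[of \<tau> s' t] r_mono tau_le E_le E_le_iff[of "u s" "u s'"]
  by (auto simp: \<sigma>_def strict_mono_less_eq)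

lemma mean_on_tangent: "PY s = s * (q (\<sigma> s) - m (\<sigma> s) * p (\<sigma> s)) + m (\<sigma> s) * PX s"
proof -
  have b: "Y b = q (r \<tau>) + m (r \<tau>) * (X b - p (r \<tau>))"
    using b_line by (simp add: tangent_height_def)
  note q = q_r[of \<tau>, symmetric] q_r[of t, symmetric]
  show ?thesis
    using T0_less E_le by (simp add: prim_def \<sigma>_def b q algebra_simps)
qed

lemma mean_left_of_tangency:
  assumes "0 < s" "s \<le> E t"
  shows "PX s \<le> s * p (\<sigma> s)"
proof -
  consider "s \<le> T0" | "T0 < s" "s \<le> E \<tau>" | "E \<tau> < s" by linarith
  then show ?thesis
  proof cases
    case 2
    have "(E \<tau> - s) * X \<tau> \<ge> (E \<tau> - s) * p (r \<tau>)"
      using 2 r(1)[of \<tau>] by (simp add: mult_left_mono)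
    then show ?thesis using 2 join_X by (simp add: prim_def \<sigma>_def algebra_simps)
  qed (use assms b_left T0_less in \<open>auto simp: prim_def \<sigma>_def\<close>)
qed

text \<open>The lower bound is Jensen's inequality. For the upper bound consider the tangent line with parameter
  \<open>\<sigma> c\<close>. The mean over \<open>[0, c]\<close> lies on it. The mean over \<open>[0, a]\<close> lies above it: this mean is on the
  earlier tangent line with parameter \<open>\<sigma> a\<close>, to the left of the tangency point, where tangent lines
  decrease as their parameter grows (for \<open>a > E t\<close> the two lines coincide). Therefore
  the mean over \<open>[a, c]\<close> lies below the line, hence below the free curve.\<close>

lemma mean_in_band:
  assumes "0 \<le> a" "a < c"
  shows "((PX c - PX a) / (c - a), (PY c - PY a) / (c - a)) \<in> band"
proof -
  define C1 C2 where "C1 = (PX c - PX a) / (c - a)" "C2 = (PY c - PY a) / (c - a)"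
  have C: "C1 * (c - a) = PX c - PX a" "C2 * (c - a) = PY c - PY a"
    using assms by (simp_all add: C1_C2_def)
  have const: "((\<lambda>s. d) has_integral (c - a) * d) {a..c}" for d :: real
    using has_integral_const_real[of d a c] assms by simp
  have "(c - a) * X b \<le> PX c - PX a" "PX c - PX a \<le> (c - a) * X t"
    using assms psi_bounds fixed.x_le_iff
    by (auto intro!: has_integral_le[OF const integral_X] has_integral_le[OF integral_X const])
  then have "X b \<le> C1" "C1 \<le> X t"
    using assms by (simp_all add: C1_C2_def field_simps)
  then obtain v where v: "X v = C1" using fixed.range_x_between by blast
  obtain s where s: "p s = C1" using X_in_range_p[of v] v by metis
  have "Y v \<le> C2"
  proof -
    have "((\<lambda>s. (Y v - k v * X v) + k v * X (\<psi> s)) has_integral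
        (c - a) * (Y v - k v * X v) + k v * (PX c - PX a)) {a..c}"
      using assms by (intro has_integral_add const has_integral_mult_right integral_X) simp
    then have "(c - a) * (Y v - k v * X v) + k v * (PX c - PX a) \<le> PY c - PY a"
    proof (rule has_integral_le[OF _ integral_Y])
      show "(Y v - k v * X v) + k v * X (\<psi> z) \<le> Y (\<psi> z)" for z
        using fixed.L_le[of v "\<psi> z"] by (simp add: tangent_height_def algebra_simps)
    qed (use assms in auto)
    then have "(c - a) * Y v \<le> (c - a) * C2"
      unfolding v C[symmetric] by (simp add: algebra_simps)
    then show ?thesis using assms by simp
  qed
  moreover have "C2 \<le> q s"
  proof -
    \<comment> \<open>\<open>H d s\<close> is \<open>s\<close> times the height of the mean over \<open>[0, s]\<close> above the tangent line with parameter
      \<open>d\<close>; in this form the value for \<open>[a, c]\<close> is the difference of those for \<open>c\<close> and \<open>a\<close>.\<close>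
    define H where "H d s = PY s - (s * (q d - m d * p d) + m d * PX s)" for d s
    have H0: "H (\<sigma> s) s = 0" for s using mean_on_tangent[of s] by (simp add: H_def)
    have "0 \<le> H (\<sigma> c) a"
    proof (cases "a = 0 \<or> \<sigma> a = \<sigma> c")
      case True
      then show ?thesis using H0[of a] by (auto simp: H_def prim_0)
    next
      case False
      then have a: "0 < a" "a \<le> E t" and less: "\<sigma> a < \<sigma> c"
        using assms E_le sigma_mono[of a c] by (auto simp: \<sigma>_def split: if_splits)
      then have "PX a / a \<le> p (\<sigma> a)"
        using mean_left_of_tangency[of a] by (simp add: field_simps)
      from free.L_less_left[OF less this]
      have "a * free.L (\<sigma> c) (PX a / a) \<le> a * free.L (\<sigma> a) (PX a / a)" using a by simp
      moreover have "H d a = PY a - a * free.L d (PX a / a)" for d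
        using a by (simp add: H_def tangent_height_def field_simps)
      ultimately show ?thesis using H0[of a] by simp
    qed
    then have "H (\<sigma> c) c - H (\<sigma> c) a \<le> 0" using H0[of c] by simp
    moreover have "H d c - H d a
        = (PY c - PY a) - (c - a) * (q d - m d * p d) - m d * (PX c - PX a)" for d
      by (simp add: H_def algebra_simps)
    ultimately have "(c - a) * (C2 - free.L (\<sigma> c) C1) \<le> 0"
      unfolding C[symmetric] by (simp add: tangent_height_def algebra_simps)
    then have "C2 \<le> free.L (\<sigma> c) C1" using assms by (simp add: mult_le_0_iff)
    also have "\<dots> \<le> q s" using free.L_le[of "\<sigma> c" s] s by simp
    finally show ?thesis .
  qed
  ultimately show ?thesis using bandI[OF v s] by (simp add: C1_C2_def)
qed

end

section \<open>Tangent segments and the band\<close>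

context tangent_band
begin

lemma Y_below_point:
  assumes "p s = X v"
  shows "Y t + k t * (p s - X t) \<le> q s"
  using fixed.L_le[of t v] fixed_below_free[OF assms] assms by (simp add: tangent_height_def)

text \<open>The segment is below the free curve because the tangent is, and above the fixed curve because the
  region above a convex curve is convex and contains both ends.\<close>

lemma tangent_segment_in_band:
  assumes "free.L s (X t) = Y t"
  shows "closed_segment (X t, Y t) (p s, q s) \<subseteq> band"
proof
  fix z assume "z \<in> closed_segment (X t, Y t) (p s, q s)"
  then obtain l where l: "0 \<le> l" "l \<le> 1" and z: "z = ((1 - l) * X t + l * p s, (1 - l) * Y t + l * q s)"
    by (auto simp: in_segment)
  define z1 where "z1 = (1 - l) * X t + l * p s"
  obtain w where w: "X w = p s" using p_in_range_X by blast
  have "convex (range X)"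
    by (simp add: connected_convex_1[symmetric] connected_continuous_image fixed.x_cont)
  then have "z1 \<in> range X"
    using convexD_alt[of "range X" "X t" "X w" l] l unfolding w by (simp add: z1_def flip: w)
  then obtain v where v: "X v = z1" by blast
  obtain s' where s': "p s' = z1" using X_in_range_p[of v] v by metis
  have "(1 - l) * (Y v + k v * (X t - X v)) + l * (Y v + k v * (p s - X v))
      \<le> (1 - l) * Y t + l * q s"
    using l Y_below_point[OF w[symmetric], of v] fixed.L_le[of v t]
    by (intro add_mono mult_left_mono) (auto simp: tangent_height_def)
  moreover have "(1 - l) * (Y v + k v * (X t - X v)) + l * (Y v + k v * (p s - X v))
      = Y v + k v * (z1 - X v)"
    by (simp add: z1_def algebra_simps)
  ultimately have "Y v \<le> (1 - l) * Y t + l * q s" using v by simp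
  moreover have "(1 - l) * Y t + l * q s = free.L s z1"
    unfolding assms[symmetric] by (simp add: z1_def tangent_height_def algebra_simps)
  then have "(1 - l) * Y t + l * q s \<le> q s'"
    using free.L_le[of s s'] s' by simp
  ultimately show "z \<in> band" using bandI[OF v s'] z z1_def by simp
qed

lemma free_curve_in_band: "(p s, q s) \<in> band"
proof -
  obtain v where "X v = p s" using p_in_range_X by blast
  then show ?thesis using bandI[of v "p s" s "q s"] fixed_below_free[of s v] by simp
qed

text \<open>A point outside the band escapes to infinity along a vertical ray that avoids the band, so it
  cannot be enclosed by a subset of the band.\<close>

lemma inside_subset_band:
  assumes "B \<subseteq> band"
  shows "inside B \<subseteq> band"
proof (rule subsetI, rule ccontr)
  fix z assume z: "z \<in> inside B" "z \<notin> band"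
  obtain z1 z2 where z12: "z = (z1, z2)" by (cases z)
  have no: "\<not> (\<exists>V. connected V \<and> z2 \<in> V \<and> \<not> bounded V \<and> (\<lambda>y. (z1, y)) ` V \<inter> band = {})"
  proof (intro notI, elim exE conjE)
    fix V assume V: "connected V" "z2 \<in> V" "\<not> bounded V" "(\<lambda>y. (z1, y)) ` V \<inter> band = {}"
    have "connected ((\<lambda>y. (z1, y)) ` V)"
      by (intro connected_continuous_image V continuous_intros)
    then have "(\<lambda>y. (z1, y)) ` V \<subseteq> connected_component_set (- B) z"
      using V assms z12 by (intro connected_component_maximal) auto
    moreover have "bounded (connected_component_set (- B) z)"
      using z by (simp add: inside_def)
    ultimately have "bounded (snd ` (\<lambda>y. (z1, y)) ` V)"
      by (meson bounded_snd bounded_subset)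
    then show False using V(3) by (simp add: image_image)
  qed
  have un: "\<not> bounded {z2..}" "\<not> bounded {..z2}"
  proof -
    have "\<exists>x\<in>{z2..}. a < norm x" "\<exists>x\<in>{..z2}. a < norm x" for a
      by (rule bexI[of _ "\<bar>z2\<bar> + \<bar>a\<bar> + 1"], simp, simp, rule bexI[of _ "- \<bar>z2\<bar> - \<bar>a\<bar> - 1"], simp, simp)
    then show "\<not> bounded {z2..}" "\<not> bounded {..z2}"
      unfolding bounded_iff by (meson not_le)+
  qed
  show False
  proof (cases "\<exists>v s. X v = z1 \<and> p s = z1 \<and> Y v \<le> z2")
    case True
    then obtain v s where vs: "X v = z1" "p s = z1" "Y v \<le> z2" by blast
    have "q s < z2" using z bandI[OF vs] z12 by (meson not_le)
    have "(z1, y) \<notin> band" if "z2 \<le> y" for y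
    proof
      assume "(z1, y) \<in> band"
      then obtain s' where "p s' = z1" "y \<le> q s'" by (auto simp: band_def)
      moreover from this have "s' = s" using free.x_eq_iff[of s' s] vs(2) by simp
      ultimately show False using \<open>q s < z2\<close> that by simp
    qed
    then show False using un(1) by - (rule notE[OF no], intro exI[of _ "{z2..}"], auto)
  next
    case False
    have "(z1, y) \<notin> band" if "y \<le> z2" for y
    proof
      assume "(z1, y) \<in> band"
      then obtain v s where "X v = z1" "p s = z1" "Y v \<le> y" unfolding band_def by blast
      with that have "Y v \<le> z2" by simp
      then show False using \<open>X v = z1\<close> \<open>p s = z1\<close> False by blast
    qed
    then show False using un(2) by - (rule notE[OF no], intro exI[of _ "{..z2}"], auto)
  qed
qed

text \<open>Roll the tangent line along the free curve until it passes through the given point, starting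
  from the tangent through the point of the fixed curve below it, which is too low, and ending at the
  tangent through the point of the free curve above it, which is too high. The tangent found has a right
  end by \<open>r_surj\<close>.\<close>

lemma band_point_on_right_tangent:
  assumes "(z1, z2) \<in> band" "(z1, z2) \<notin> range (\<lambda>t. (X t, Y t))"
  obtains t \<beta> where "0 \<le> \<beta>" "\<beta> < 1"
    "z1 = (1 - \<beta>) * p (r t) + \<beta> * X t" "z2 = (1 - \<beta>) * q (r t) + \<beta> * Y t"
proof -
  obtain v s where vs: "X v = z1" "p s = z1" "Y v \<le> z2" "z2 \<le> q s"
    using assms(1) by (auto simp: band_def)
  then have less: "Y v < z2" using assms(2) by force
  have "free.L (r v) z1 \<le> z2" using r(2)[of v] vs less by simp
  moreover have "r v \<le> s" using r(1)[of v] vs free.x_less_iff[of "r v" s] by simp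
  moreover have "z2 \<le> free.L s z1" using vs free.L_self[of s] by simp
  ultimately obtain d where d: "free.L d z1 = z2" "d \<le> s"
    using IVT'[OF _ _ _ free.L_cont] by blast
  obtain t where t: "r t = d" using r_surj .
  have "p d \<le> z1" using d(2) vs(2) free.x_le_iff[of d s] by simp
  obtain b where b: "X b < p (r t)" "b < t" "free.L (r t) (X b) = Y b" using left_end .
  have "z1 < X t"
  proof (rule ccontr)
    assume "\<not> z1 < X t"
    then have "t \<le> v" using vs fixed.x_le_iff by (metis not_le)
    moreover have "v \<noteq> t" using less d t r(2)[of t] vs by auto
    ultimately have "free.L d (X v) < Y v"
      using fixed.chord_right[of b t "q d - m d * p d" "m d" v] b r(2)[of t] t
      by (simp add: tangent_as_line)
    then show False using d vs less by simp
  qed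
  define \<beta> where "\<beta> = (z1 - p d) / (X t - p d)"
  have pos: "0 < X t - p d" using r(1)[of t] t by simp
  have \<beta>: "\<beta> * (X t - p d) = z1 - p d" using pos by (simp add: \<beta>_def)
  have "z2 = q d + m d * (\<beta> * (X t - p d))"
    using d \<beta> by (simp add: tangent_height_def)
  also have "\<dots> = (1 - \<beta>) * q d + \<beta> * Y t"
    unfolding q_r[of t, symmetric] t by (simp add: algebra_simps)
  finally have z2: "z2 = (1 - \<beta>) * q (r t) + \<beta> * Y t" using t by simp
  have z1: "z1 = (1 - \<beta>) * p (r t) + \<beta> * X t" using \<beta> t by (simp add: algebra_simps)
  have "0 \<le> \<beta>" "\<beta> < 1" using pos \<open>p d \<le> z1\<close> \<open>z1 < X t\<close> by (simp_all add: \<beta>_def)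
  then show thesis using that z1 z2 by blast
qed

end

section \<open>The family of curves\<close>

lemma derivs_of_C3:
  fixes h h1 h2 h3 :: "real \<Rightarrow> real"
  assumes "\<And>s. (h has_real_derivative h1 s) (at s)" "\<And>s. (h1 has_real_derivative h2 s) (at s)"
    "\<And>s. (h2 has_real_derivative h3 s) (at s)"
  shows "(h has_real_derivative deriv h s) (at s)"
    "(deriv h has_real_derivative deriv (deriv h) s) (at s)"
    "isCont (deriv h) s" "isCont (deriv (deriv h)) s"
proof -
  have "deriv h = h1" "deriv h1 = h2" using assms DERIV_imp_deriv by blast+
  then show "(h has_real_derivative deriv h s) (at s)"
    "(deriv h has_real_derivative deriv (deriv h) s) (at s)"
    "isCont (deriv h) s" "isCont (deriv (deriv h)) s"
    using assms DERIV_isCont by metis+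
qed

context curve_family
begin

lemma crv_derivs:
  assumes c: "c \<in> eps_range emax"
  shows "(crv1 G c has_real_derivative deriv (crv1 G c) s) (at s)"
    "(deriv (crv1 G c) has_real_derivative deriv (deriv (crv1 G c)) s) (at s)"
    "isCont (deriv (crv1 G c)) s" "isCont (deriv (deriv (crv1 G c))) s"
    "(crv2 G c has_real_derivative deriv (crv2 G c) s) (at s)"
    "(deriv (crv2 G c) has_real_derivative deriv (deriv (crv2 G c)) s) (at s)"
    "isCont (deriv (crv2 G c)) s" "isCont (deriv (deriv (crv2 G c))) s"
proof -
  obtain D where D: "D 0 0 = G"
    and D': "\<forall>i<3. \<forall>j\<le>(1::nat). \<forall>t. \<forall>e\<in>eps_range emax.
           ((\<lambda>s. D i j s e) has_vector_derivative D (Suc i) j t e) (at t)"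
    using smooth unfolding C31_smooth_def by blast
  have v: "((\<lambda>s. D i 0 s c) has_vector_derivative D (Suc i) 0 t c) (at t)" if "i < 3" for i t
    using D' that c by auto
  have "((\<lambda>s. fst (D i 0 s c)) has_real_derivative fst (D (Suc i) 0 t c)) (at t)"
    "((\<lambda>s. snd (D i 0 s c)) has_real_derivative snd (D (Suc i) 0 t c)) (at t)" if "i < 3" for i t
    using bounded_linear.has_vector_derivative[OF bounded_linear_fst v[OF that]]
      bounded_linear.has_vector_derivative[OF bounded_linear_snd v[OF that]]
    by (simp_all add: has_real_derivative_iff_has_vector_derivative)
  then have f: "(crv1 G c has_real_derivative fst (D (Suc 0) 0 t c)) (at t)"
      "((\<lambda>s. fst (D (Suc 0) 0 s c)) has_real_derivative fst (D (Suc (Suc 0)) 0 t c)) (at t)"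
      "((\<lambda>s. fst (D (Suc (Suc 0)) 0 s c)) has_real_derivative fst (D (Suc (Suc (Suc 0))) 0 t c)) (at t)"
    and g: "(crv2 G c has_real_derivative snd (D (Suc 0) 0 t c)) (at t)"
      "((\<lambda>s. snd (D (Suc 0) 0 s c)) has_real_derivative snd (D (Suc (Suc 0)) 0 t c)) (at t)"
      "((\<lambda>s. snd (D (Suc (Suc 0)) 0 s c)) has_real_derivative snd (D (Suc (Suc (Suc 0))) 0 t c)) (at t)" for t
    unfolding crv1_def[abs_def] crv2_def[abs_def] using D by fastforce+
  show "(crv1 G c has_real_derivative deriv (crv1 G c) s) (at s)"
    "(deriv (crv1 G c) has_real_derivative deriv (deriv (crv1 G c)) s) (at s)"
    "isCont (deriv (crv1 G c)) s" "isCont (deriv (deriv (crv1 G c))) s"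
    by (rule derivs_of_C3[OF f])+
  show "(crv2 G c has_real_derivative deriv (crv2 G c) s) (at s)"
    "(deriv (crv2 G c) has_real_derivative deriv (deriv (crv2 G c)) s) (at s)"
    "isCont (deriv (crv2 G c)) s" "isCont (deriv (deriv (crv2 G c))) s"
    by (rule derivs_of_C3[OF g])+
qed

definition tan_slope :: "real \<Rightarrow> real \<Rightarrow> real" where
  "tan_slope c s = deriv (crv2 G c) s / deriv (crv1 G c) s"

definition tan_slope' :: "real \<Rightarrow> real \<Rightarrow> real" where
  "tan_slope' c s = (deriv (deriv (crv2 G c)) s * deriv (crv1 G c) s
     - deriv (crv2 G c) s * deriv (deriv (crv1 G c)) s) / (deriv (crv1 G c) s)\<^sup>2"

lemma convex_param_crv:
  assumes c: "c \<in> eps_range emax"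
  shows "convex_param (crv1 G c) (crv2 G c) (tan_slope c) (deriv (crv1 G c)) (tan_slope' c)"
proof
  note D = crv_derivs[OF c] and pos = deriv_crv1_pos[OF c]
  fix s
  show "(crv1 G c has_real_derivative deriv (crv1 G c) s) (at s)" by (rule D)
  show "deriv (crv1 G c) s > 0" by (rule pos)
  show "(crv2 G c has_real_derivative tan_slope c s * deriv (crv1 G c) s) (at s)"
    using D(5)[of s] pos[of s] by (simp add: tan_slope_def)
  show "tan_slope' c s > 0"
    using convex_curve[OF c, of s] pos[of s] by (simp add: tan_slope'_def)
  show "(tan_slope c has_real_derivative tan_slope' c s) (at s)"
    unfolding tan_slope_def[abs_def] tan_slope'_def power2_eq_square
    using pos[of s] by (intro DERIV_divide D) simp
qed

lemma zero_in_range: "0 \<in> eps_range emax"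
  using emax_pos by (simp add: eps_range_def zero_ereal_def)

lemma vector_derivative_G:
  assumes c: "c \<in> eps_range emax"
  shows "vector_derivative (\<lambda>t. G t c) (at s) = (deriv (crv1 G c) s, deriv (crv2 G c) s)"
proof -
  have "((\<lambda>t. (crv1 G c t, crv2 G c t)) has_vector_derivative
      (deriv (crv1 G c) s, deriv (crv2 G c) s)) (at s)"
    using crv_derivs[OF c, of s]
    by (intro has_vector_derivative_Pair) (simp_all add: has_real_derivative_iff_has_vector_derivative)
  then show ?thesis by (simp add: crv1_def crv2_def vector_derivative_at)
qed

lemma tangent_line_iff:
  assumes c: "c \<in> eps_range emax"
  shows "(z1, z2) \<in> tangent_line G c s \<longleftrightarrow> tangent_height (crv1 G c) (crv2 G c) (tan_slope c) s z1 = z2"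
proof -
  have G: "G s c = (crv1 G c s, crv2 G c s)" by (simp add: crv1_def crv2_def)
  note pos = deriv_crv1_pos[OF c, of s]
  have "(z1, z2) \<in> tangent_line G c s \<longleftrightarrow> (\<exists>l. z1 = crv1 G c s + l * deriv (crv1 G c) s
      \<and> z2 = crv2 G c s + l * deriv (crv2 G c) s)"
    unfolding tangent_line_def vector_derivative_G[OF c] G by auto
  also have "\<dots> \<longleftrightarrow> tangent_height (crv1 G c) (crv2 G c) (tan_slope c) s z1 = z2"
  proof
    assume "\<exists>l. z1 = crv1 G c s + l * deriv (crv1 G c) s \<and> z2 = crv2 G c s + l * deriv (crv2 G c) s"
    then show "tangent_height (crv1 G c) (crv2 G c) (tan_slope c) s z1 = z2"
      using pos by (auto simp: tangent_height_def tan_slope_def)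
  next
    assume "tangent_height (crv1 G c) (crv2 G c) (tan_slope c) s z1 = z2"
    then show "\<exists>l. z1 = crv1 G c s + l * deriv (crv1 G c) s \<and> z2 = crv2 G c s + l * deriv (crv2 G c) s"
      using pos by (intro exI[of _ "(z1 - crv1 G c s) / deriv (crv1 G c) s"])
        (auto simp: tangent_height_def tan_slope_def)
  qed
  finally show ?thesis .
qed

end

locale curve_family_at = curve_family +
  fixes e :: real
  assumes e_pos: "0 < e" and e_less: "ereal e < emax"

sublocale curve_family_at \<subseteq>
  tangent_band "crv1 G e" "crv2 G e" "tan_slope e" "deriv (crv1 G e)" "tan_slope' e"
    "crv1 G 0" "crv2 G 0" "tan_slope 0" "deriv (crv1 G 0)" "tan_slope' 0"
proof -
  have e: "e \<in> eps_range emax" using e_pos e_less by (simp add: eps_range_def)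
  interpret free: convex_param "crv1 G e" "crv2 G e" "tan_slope e" "deriv (crv1 G e)" "tan_slope' e"
    by (rule convex_param_crv[OF e])
  interpret fixed: convex_param "crv1 G 0" "crv2 G 0" "tan_slope 0" "deriv (crv1 G 0)" "tan_slope' 0"
    by (rule convex_param_crv[OF zero_in_range])
  have G0: "G t 0 = (crv1 G 0 t, crv2 G 0 t)" for t by (simp add: crv1_def crv2_def)
  show "tangent_band (crv1 G e) (crv2 G e) (tan_slope e) (deriv (crv1 G e)) (tan_slope' e)
    (crv1 G 0) (crv2 G 0) (tan_slope 0) (deriv (crv1 G 0)) (tan_slope' 0)"
  proof
    fix s t
    show "isCont (deriv (crv1 G e)) s" "isCont (deriv (crv1 G 0)) t"
      by (rule crv_derivs[OF e] crv_derivs[OF zero_in_range])+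
    show "isCont (tan_slope' e) s"
      unfolding tan_slope'_def using deriv_crv1_pos[OF e, of s]
      by (intro continuous_intros crv_derivs[OF e]) simp
    show "crv2 G 0 t < crv2 G e s" if "crv1 G e s = crv1 G 0 t"
    proof (rule ccontr)
      assume le: "\<not> crv2 G 0 t < crv2 G e s"
      have "G t 0 \<in> closure (Xi G e)"
      proof (unfold closure_approachable, intro allI impI)
        fix d :: real assume "0 < d"
        then have "(crv1 G e s, crv2 G 0 t + d / 2) \<in> Xi G e" using le by (auto simp: Xi_def)
        moreover have "dist (crv1 G e s, crv2 G 0 t + d / 2) (G t 0) < d"
          using \<open>0 < d\<close> by (simp add: G0 that dist_Pair_Pair dist_real_def)
        ultimately show "\<exists>y\<in>Xi G e. dist y (G t 0) < d" by blast
      qed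
      then show False using Xi_strict[OF zero_in_range e e_pos, of t] by simp
    qed
    show "\<exists>t. crv1 G 0 t = crv1 G e s"
    proof -
      have "(crv1 G e s, crv2 G e s + 1) \<in> Xi G e" by (auto simp: Xi_def)
      then have "(crv1 G e s, crv2 G e s + 1) \<in> Xi G 0" using Xi_mono[OF zero_in_range e e_pos] by blast
      then show ?thesis by (auto simp: Xi_def intro: sym)
    qed
    show "\<exists>s1 s2. s1 < s2 \<and> free.L s1 (crv1 G 0 t) = crv2 G 0 t \<and> free.L s2 (crv1 G 0 t) = crv2 G 0 t"
    proof -
      obtain l1 l2 where "l1 \<noteq> l2" "tangents_from G e t = {l1, l2}"
        using two_tangents[OF e_pos e_less, of t] by (auto simp: card_2_iff)
      then have "l1 \<in> tangents_from G e t" "l2 \<in> tangents_from G e t" "l1 \<noteq> l2" by auto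
      then obtain s1 s2 where s: "tangent_line G e s1 \<noteq> tangent_line G e s2"
        "G t 0 \<in> tangent_line G e s1" "G t 0 \<in> tangent_line G e s2"
        unfolding tangents_from_def by blast
      then have "s1 < s2 \<or> s2 < s1" by (metis linorder_neqE_linordered_idom)
      then show ?thesis using s(2,3) unfolding G0 tangent_line_iff[OF e] by blast
    qed
    show "\<exists>b. b \<noteq> t \<and> free.L s (crv1 G 0 b) = crv2 G 0 b" if "free.L s (crv1 G 0 t) = crv2 G 0 t"
    proof -
      have t: "G t 0 \<in> tangent_line G e s" using that unfolding G0 tangent_line_iff[OF e] .
      then have "tangent_line G e s \<in> tangents_from G e t" by (auto simp: tangents_from_def)
      from tangents_meet_twice[OF e_pos e_less this]
      obtain z z' where "z \<noteq> z'" "tangent_line G e s \<inter> fixed_boundary G = {z, z'}"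
        by (auto simp: card_2_iff)
      then obtain y where "y \<in> tangent_line G e s" "y \<in> fixed_boundary G" "y \<noteq> G t 0"
        by (metis Int_iff insertCI)
      then obtain b where "G b 0 \<in> tangent_line G e s" "b \<noteq> t" by (auto simp: fixed_boundary_def)
      then show ?thesis unfolding G0 tangent_line_iff[OF e] by blast
    qed
  qed
qed

context curve_family_at
begin

lemma e_in_range: "e \<in> eps_range emax"
  using e_pos e_less by (simp add: eps_range_def)

lemma G_0: "G t 0 = (crv1 G 0 t, crv2 G 0 t)" and G_e: "G t e = (crv1 G e t, crv2 G e t)"
  by (simp_all add: crv1_def crv2_def)

lemma tangency_params_G: "tangency_params G e t = {s. free.L s (crv1 G 0 t) = crv2 G 0 t}"
  unfolding tangency_params_def G_0 tangent_line_iff[OF e_in_range] ..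

lemma s_R_eq: "s_R G e t = r t"
  and s_L_tangent: "free.L (s_L G e t) (crv1 G 0 t) = crv2 G 0 t"
proof -
  obtain l where l: "{s. free.L s (crv1 G 0 t) = crv2 G 0 t} = {r t, l}" "r t < l"
    using tangency_params_eq[of t] .
  show "s_R G e t = r t" unfolding s_R_def tangency_params_G l(1) using l(2) by simp
  have "s_L G e t = l" unfolding s_L_def tangency_params_G l(1) using l(2) by simp
  then show "free.L (s_L G e t) (crv1 G 0 t) = crv2 G 0 t" using l(1) by blast
qed

lemma w_R_eq: "w_R G e t = (crv1 G e (r t), crv2 G e (r t))"
  by (simp add: w_R_def s_R_eq G_e)

text \<open>Both components of \<open>g - w\<close> are multiplied by the same factor \<open>lam\<close> in \<open>w'\<close>, and the first component is
  nonzero, so the description operator in \<open>lambda_R\<close> has \<open>lam t\<close> as its only candidate.\<close>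

lemma lambda_R_eq: "lambda_R G e t = lam t"
proof -
  have "((\<lambda>t. (crv1 G e (r t), crv2 G e (r t))) has_vector_derivative
     (lam t * (crv1 G 0 t - crv1 G e (r t)), lam t * (crv2 G 0 t - crv2 G e (r t)))) (at t)"
    using p_r_deriv[of t] q_r_deriv[of t]
    by (intro has_vector_derivative_Pair) (simp_all add: has_real_derivative_iff_has_vector_derivative)
  then have *: "vector_derivative (w_R G e) (at t)
      = (lam t * (crv1 G 0 t - crv1 G e (r t)), lam t * (crv2 G 0 t - crv2 G e (r t)))"
    unfolding w_R_eq[abs_def] by (rule vector_derivative_at)
  show ?thesis
    unfolding lambda_R_def * unfolding w_R_eq G_0
    by (rule the_equality) (use r(1)[of t] in auto)
qed

lemma triangle_boundary_subset_band: "triangle_boundary G e t \<subseteq> band"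
  using tangent_segment_in_band[OF r(2), of t] tangent_segment_in_band[OF s_L_tangent, of t]
    free_curve_in_band
  unfolding triangle_boundary_def w_R_def w_L_def s_R_eq G_0 G_e by auto

text \<open>The segments of the right tangents alone already fill the band, and the triangles do not leave it, since
  their boundaries do not.\<close>

lemma Omega_eq_band: "Omega G e = band"
proof
  show "Omega G e \<subseteq> band"
    using triangle_boundary_subset_band inside_subset_band
    unfolding Omega_def triangle_def by blast
  show "band \<subseteq> Omega G e"
  proof
    fix z assume z: "z \<in> band"
    obtain z1 z2 where z12: "z = (z1, z2)" by (cases z)
    have "\<exists>t. z \<in> closed_segment (G t 0) (w_R G e t)"
    proof (cases "z \<in> range (\<lambda>t. (crv1 G 0 t, crv2 G 0 t))")
      case True
      then show ?thesis unfolding G_0 by auto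
    next
      case False
      obtain t \<beta> where "0 \<le> \<beta>" "\<beta> < 1"
        "z1 = (1 - \<beta>) * crv1 G e (r t) + \<beta> * crv1 G 0 t"
        "z2 = (1 - \<beta>) * crv2 G e (r t) + \<beta> * crv2 G 0 t"
        using band_point_on_right_tangent[OF z[unfolded z12] False[unfolded z12]] .
      then have "z \<in> closed_segment (w_R G e t) (G t 0)"
        unfolding in_segment G_0 w_R_eq z12 by (intro conjI exI[of _ \<beta>]) auto
      then show ?thesis by (metis closed_segment_commute)
    qed
    then show "z \<in> Omega G e"
      unfolding Omega_def triangle_def triangle_boundary_def by blast
  qed
qed

end

section \<open>Averages over bounded intervals\<close>

lemma nondeg_interval_ends:
  assumes "nondeg_interval J"
  obtains a c :: real where "a < c" "{a<..<c} \<subseteq> J" "J \<subseteq> {a..c}"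
proof -
  have J: "is_interval J" "bounded J" "interior J \<noteq> {}" using assms by (auto simp: nondeg_interval_def)
  then have ne: "J \<noteq> {}" by auto
  have bdd: "bdd_below J" "bdd_above J" using J(2) by (auto simp: bounded_imp_bdd_below bounded_imp_bdd_above)
  have sub: "J \<subseteq> {Inf J..Sup J}" using bdd by (auto simp: cInf_lower cSup_upper)
  have op: "{Inf J<..<Sup J} \<subseteq> J"
  proof
    fix z assume "z \<in> {Inf J<..<Sup J}"
    then obtain y y' where "y \<in> J" "y < z" "y' \<in> J" "z < y'"
      using ne bdd cInf_less_iff[of J z] less_cSup_iff[of J z] by auto
    then show "z \<in> J" using J(1) unfolding is_interval_1 by (meson less_imp_le)
  qed
  have "Inf J \<noteq> Sup J"
  proof
    assume "Inf J = Sup J"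
    then have "J \<subseteq> {Inf J}" using sub by auto
    then have "interior J \<subseteq> interior {Inf J}" by (rule interior_mono)
    then show False using J(3) by simp
  qed
  moreover obtain z where "z \<in> J" using ne by blast
  then have "Inf J \<le> Sup J" using sub by fastforce
  ultimately show thesis using that[OF _ op sub] by linarith
qed

lemma sets_measure_between:
  fixes a c :: real
  assumes "a < c" "{a<..<c} \<subseteq> J" "J \<subseteq> {a..c}"
  shows "J \<in> sets lebesgue" "measure lebesgue J = c - a"
proof -
  have "J = {a<..<c} \<union> (J \<inter> {a, c})" using assms by auto
  moreover have "{a<..<c} \<union> (J \<inter> {a, c}) \<in> sets borel"
    by (intro sets.Un borel_open open_greaterThanLessThan borel_closed finite_imp_closed) auto
  ultimately have "J \<in> sets borel" by simp
  then show J: "J \<in> sets lebesgue" by simp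
  then have Jm: "J \<in> lmeasurable"
    using assms(3) by (meson bounded_set_imp_lmeasurable bounded_subset compact_Icc compact_imp_bounded)
  have "measure lebesgue {a<..<c} \<le> measure lebesgue J"
    using assms J Jm by (intro measure_mono_fmeasurable) auto
  moreover have "measure lebesgue J \<le> measure lebesgue {a..c}"
    using assms J by (intro measure_mono_fmeasurable) auto
  ultimately show "measure lebesgue J = c - a" using assms by simp
qed

lemma has_integral_between:
  fixes h :: "real \<Rightarrow> 'b::banach"
  assumes "{a<..<c} \<subseteq> J" "J \<subseteq> {a..c}" "(h has_integral i) {a..c}"
  shows "(h has_integral i) J"
proof -
  have "negligible {x \<in> J - {a..c}. h x \<noteq> 0}" 
    by (rule negligible_subset[of "{}"]) (use assms in auto)
  moreover have "negligible {x \<in> {a..c} - J. h x \<noteq> 0}"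
  proof (rule negligible_subset[of "{a, c}"])
    have "{a..c} - {a<..<c} \<subseteq> {a, c}" by auto
    then show "{x \<in> {a..c} - J. h x \<noteq> 0} \<subseteq> {a, c}" using assms(1) by blast
  qed simp
  ultimately show ?thesis using has_integral_spike_set_eq[of J "{a..c}" h i] assms(3) by blast
qed

lemma set_integrable_bounded_between:
  fixes h :: "real \<Rightarrow> 'b::euclidean_space"
  assumes J: "a < c" "{a<..<c} \<subseteq> J" "J \<subseteq> {a..c}"
    and h: "h \<in> borel_measurable borel" "\<And>s. norm (h s) \<le> B"
  shows "set_integrable lebesgue J h"
proof (rule measurable_bounded_by_integrable_imp_absolutely_integrable)
  show "h \<in> borel_measurable (lebesgue_on J)"
    using h(1) by (intro measurable_restrict_space1 measurable_completion) simp
  show "J \<in> sets lebesgue" by (rule sets_measure_between[OF J])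
  show "(\<lambda>_. B) integrable_on J"
    using has_integral_between[OF J(2,3) has_integral_const_real] by blast
qed (rule h(2))

lemma set_integral_between:
  fixes h :: "real \<Rightarrow> 'b::euclidean_space"
  assumes "a < c" "{a<..<c} \<subseteq> J" "J \<subseteq> {a..c}"
    and "set_integrable lebesgue J h" "(h has_integral i) {a..c}"
  shows "set_lebesgue_integral lebesgue J h = i"
  using set_lebesgue_integral_eq_integral(2)[OF assms(4)] has_integral_between[OF assms(2,3,5)]
  by (simp add: integral_unique)

lemma has_integral_pair:
  fixes h1 h2 :: "real \<Rightarrow> real"
  assumes "(h1 has_integral i1) A" "(h2 has_integral i2) A"
  shows "((\<lambda>s. (h1 s, h2 s)) has_integral (i1, i2)) A"
proof -
  have "bounded_linear (\<lambda>z::real. (z, 0::real))" "bounded_linear (\<lambda>z::real. (0::real, z))"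
    by (intro bounded_linear_Pair bounded_linear_ident bounded_linear_zero)+
  from has_integral_linear[OF assms(1) this(1)] has_integral_linear[OF assms(2) this(2)]
  have "((\<lambda>s. (h1 s, 0) + (0, h2 s)) has_integral ((i1, 0) + (0, i2))) A"
    unfolding o_def by (rule has_integral_add)
  then show ?thesis by simp
qed

lemma has_integral_rescale:
  fixes h F :: "real \<Rightarrow> real"
  assumes "0 < l" "a \<le> c"
    and F: "\<And>a c. a \<le> c \<Longrightarrow> (h has_integral (F c - F a)) {a..c}"
  shows "((\<lambda>s. h (l * (s - A))) has_integral (F (l * (c - A)) - F (l * (a - A))) / l) {a..c}"
proof -
  have "(h has_integral (F (l * (c - A)) - F (l * (a - A)))) (cbox (l * (a - A)) (l * (c - A)))"
    using F[of "l * (a - A)" "l * (c - A)"] assms by simp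
  from has_integral_affinity'[OF this assms(1), of "- l * A"] show ?thesis
    using assms(1) by (simp add: algebra_simps add_divide_distrib diff_divide_distrib divide_inverse)
qed

text \<open>The integrals of the positive and of the negative part are finite, so the difference of extended
  numbers is the difference of real numbers.\<close>

lemma ext_average_integrable:
  assumes h: "set_integrable lebesgue I h" and I: "0 < measure lebesgue I"
  shows "has_ext_average I h"
    "ext_average I h = ereal (set_lebesgue_integral lebesgue I h / measure lebesgue I)"
proof -
  have P: "pos_integral I g = (\<integral>\<^sup>+ s. ennreal (indicator I s *\<^sub>R g s) \<partial>lebesgue)" for g
    unfolding pos_integral_def by (intro nn_integral_cong) (auto simp: indicator_def)
  have int: "integrable lebesgue (\<lambda>s. indicator I s *\<^sub>R h s)"
    using h by (simp add: set_integrable_def)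
  have fin: "pos_integral I h \<noteq> \<infinity>" "pos_integral I (\<lambda>s. - h s) \<noteq> \<infinity>"
    using integrableD(2,3)[OF int] by (simp_all add: P)
  then show "has_ext_average I h" by (simp add: has_ext_average_def less_top)
  obtain a1 a2 where a: "pos_integral I h = ennreal a1" "0 \<le> a1"
      "pos_integral I (\<lambda>s. - h s) = ennreal a2" "0 \<le> a2"
    using fin by (metis ennreal_cases infinity_ennreal_def)
  have "set_lebesgue_integral lebesgue I h = a1 - a2"
    using real_lebesgue_integral_def[OF int] a unfolding P set_lebesgue_integral_def by simp
  then show "ext_average I h = ereal (set_lebesgue_integral lebesgue I h / measure lebesgue I)"
    unfolding ext_average_def a(1,3) using a(2,4) I by (simp add: enn2ereal_ennreal)
qed

section \<open>Averages along the test functions\<close>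

context band_test
begin

lemma T_pos: "0 < T"
  using E_pos[of t] T_ge by simp

lemma curve_psi_measurable:
  assumes "continuous_on UNIV h"
  shows "(\<lambda>s. h (\<psi> (l * (s - A)))) \<in> borel_measurable borel"
proof -
  have "h \<in> borel_measurable borel" using assms by (rule borel_measurable_continuous_onI)
  moreover have "\<psi> \<in> borel_measurable borel" using psi_mono by (rule borel_measurable_mono)
  ultimately show ?thesis by measurable
qed

lemma curve_psi_bounded:
  fixes h :: "real \<Rightarrow> 'b::euclidean_space"
  assumes "continuous_on UNIV h"
  obtains B where "\<And>s. norm (h (\<psi> s)) \<le> B"
proof -
  have "compact (h ` {b..t})"
    by (intro compact_continuous_image continuous_on_subset[OF assms]) auto
  then obtain B where B: "\<forall>z\<in>h ` {b..t}. norm z \<le> B" using compact_imp_bounded bounded_iff by metis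
  have "norm (h (\<psi> s)) \<le> B" for s
    using B psi_bounds(1,2)[of s] by auto
  then show thesis using that by blast
qed

lemma curve_psi_integrable:
  fixes h :: "real \<Rightarrow> 'b::euclidean_space"
  assumes h: "continuous_on UNIV h" and J: "a < c" "{a<..<c} \<subseteq> J" "J \<subseteq> {a..c}"
  shows "set_integrable lebesgue J (\<lambda>s. h (\<psi> (l * (s - A))))"
proof -
  obtain B where "\<And>s. norm (h (\<psi> s)) \<le> B" using curve_psi_bounded[OF h] by blast
  then show ?thesis
    by (intro set_integrable_bounded_between[OF J] curve_psi_measurable[OF h])
qed

lemma average_test:
  assumes J: "a < c" "{a<..<c} \<subseteq> J" "J \<subseteq> {a..c}" and l: "0 < l"
  shows "average J (\<lambda>s. (X (\<psi> (l * (s - A))), Y (\<psi> (l * (s - A)))))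
    = ((PX (l * (c - A)) - PX (l * (a - A))) / (l * (c - A) - l * (a - A)),
       (PY (l * (c - A)) - PY (l * (a - A))) / (l * (c - A) - l * (a - A)))"
proof -
  have c: "continuous_on UNIV (\<lambda>s. (X s, Y s))"
    by (intro continuous_intros fixed.x_cont fixed.y_cont)
  have "set_lebesgue_integral lebesgue J (\<lambda>s. (X (\<psi> (l * (s - A))), Y (\<psi> (l * (s - A)))))
     = ((PX (l * (c - A)) - PX (l * (a - A))) / l, (PY (l * (c - A)) - PY (l * (a - A))) / l)"
    using J(1) l by (intro set_integral_between[OF J curve_psi_integrable[OF c J]] has_integral_pair
        has_integral_rescale integral_X integral_Y) simp_all
  then show ?thesis
    using J l sets_measure_between(2)[OF J] by (simp add: average_def right_diff_distrib[symmetric])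
qed

text \<open>On \<open>[0, E \<tau>]\<close> the function \<open>\<psi>\<close> has only the values \<open>b\<close> and \<open>\<tau>\<close>, where \<open>f\<close> dominates a
  multiple of \<open>Y\<close>; the integral of \<open>Y\<close> over this interval is known.\<close>

lemma integral_f_lower_bound:
  assumes f: "continuous_on UNIV f"
    and growth: "f \<tau> + N * (Y b - Y \<tau>) \<le> f b"
    and below: "\<And>s. s \<le> t \<Longrightarrow> - C \<le> f s"
    and i: "((\<lambda>s. f (\<psi> s)) has_integral i) {0..T}"
  shows "N * (E \<tau> * (q (r \<tau>) - Y \<tau>)) - C * T \<le> i"
proof -
  have int: "(\<lambda>s. f (\<psi> s)) integrable_on {a..c}" if "a < c" for a c
    using set_lebesgue_integral_eq_integral(1)[OF curve_psi_integrable[OF f that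
      greaterThanLessThan_subseteq_atLeastAtMost_iff[THEN iffD2] order_refl, of 1 0]] by simp
  have \<tau>: "0 < E \<tau>" "E \<tau> \<le> T" using E_pos[of \<tau>] E_le T_ge by auto
  obtain i1 where i1: "((\<lambda>s. f (\<psi> s)) has_integral i1) {0..E \<tau>}" using int[OF \<tau>(1)] by blast
  have const: "((\<lambda>s. d) has_integral E \<tau> * d) {0..E \<tau>}" for d :: real
    using has_integral_const_real[of d 0 "E \<tau>"] \<tau>(1) by simp
  have "((\<lambda>s. (f \<tau> - N * Y \<tau>) + N * Y (\<psi> s)) has_integral
      (E \<tau> * (f \<tau> - N * Y \<tau>) + N * (PY (E \<tau>) - PY 0))) {0..E \<tau>}"
    using \<tau>(1) by (intro has_integral_add const has_integral_mult_right integral_Y) simp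
  moreover have "(f \<tau> - N * Y \<tau>) + N * Y (\<psi> s) \<le> f (\<psi> s)" if "s \<in> {0..E \<tau>}" for s
    using psi_cases[of s] that E_le growth by (auto simp: algebra_simps)
  ultimately have "E \<tau> * (f \<tau> - N * Y \<tau>) + N * (E \<tau> * q (r \<tau>)) \<le> i1"
    using has_integral_le[OF _ i1] prim_tau[of "\<lambda>s. q (r s)" Y, OF join_Y] prim_0 by fastforce
  moreover have "E \<tau> * (- C) \<le> E \<tau> * f \<tau>"
    using below[OF tau_le] \<tau>(1) by (intro mult_left_mono) auto
  ultimately have first: "N * (E \<tau> * (q (r \<tau>) - Y \<tau>)) - C * E \<tau> \<le> i1"
    by (simp add: algebra_simps)
  show ?thesis
  proof (cases "E \<tau> = T")
    case True
    then show ?thesis using first i1 i has_integral_unique by blast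
  next
    case False
    then obtain i2 where i2: "((\<lambda>s. f (\<psi> s)) has_integral i2) {E \<tau>..T}" using int \<tau>(2) by force
    have "((\<lambda>s. - C) has_integral (T - E \<tau>) *\<^sub>R (- C)) {E \<tau>..T}"
      using has_integral_const_real[of "- C" "E \<tau>" T] \<tau>(2) by simp
    then have "(T - E \<tau>) *\<^sub>R (- C) \<le> i2"
      by (rule has_integral_le[OF _ i2]) (rule below[OF psi_bounds(2)])
    moreover have "((\<lambda>s. f (\<psi> s)) has_integral (i1 + i2)) {0..T}"
      using has_integral_combine[OF _ \<tau>(2) i1 i2] \<tau>(1) by simp
    then have "i = i1 + i2" using i by (rule has_integral_unique[symmetric])
    ultimately show ?thesis using first by (simp add: algebra_simps)
  qed
qed

end

section \<open>Behaviour near minus infinity\<close>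

lemma bounded_below_left:
  fixes f :: "real \<Rightarrow> real"
  assumes "continuous_on UNIV f" "\<And>s. s \<le> t0 \<Longrightarrow> f t0 \<le> f s"
  obtains C where "\<And>s. s \<le> t \<Longrightarrow> - C \<le> f s"
proof -
  have "compact (f ` {t0..max t0 t})"
    by (intro compact_continuous_image continuous_on_subset[OF assms(1)]) auto
  then obtain C where C: "\<forall>z\<in>f ` {t0..max t0 t}. norm z \<le> C"
    using compact_imp_bounded bounded_iff by metis
  have "- C \<le> f s" if "s \<le> t" for s
  proof (cases "s \<le> t0")
    case True
    have "\<bar>f t0\<bar> \<le> C" using C by simp
    then have "- C \<le> f t0" by simp
    then show ?thesis using assms(2)[OF True] by simp
  next
    case False
    then have "\<bar>f s\<bar> \<le> C" using C that by simp
    then show ?thesis by simp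
  qed
  then show thesis using that by blast
qed

context curve_family_at
begin

abbreviation "X \<equiv> crv1 G 0"
abbreviation "Y \<equiv> crv2 G 0"
abbreviation "p \<equiv> crv1 G e"
abbreviation "q \<equiv> crv2 G e"

lemma kappa2_eq: "kappa2 G = tan_slope 0"
  by (simp add: fun_eq_iff kappa2_def tan_slope_def)

lemma lam_antiderivative:
  obtains \<Lambda> where "\<And>s. (\<Lambda> has_real_derivative lam s) (at s)"
proof -
  obtain \<Lambda> where "\<forall>s::real. - \<infinity> < ereal s \<longrightarrow> ereal s < \<infinity> \<longrightarrow> (\<Lambda> has_vector_derivative lam s) (at s)"
    using einterval_antiderivative[of "- \<infinity>" \<infinity> lam] isCont_lam by auto
  then show thesis using that[of \<Lambda>] by (simp add: has_real_derivative_iff_has_vector_derivative)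
qed

lemma theta_R_eq:
  assumes \<Lambda>: "\<And>s. (\<Lambda> has_real_derivative lam s) (at s)"
  shows "theta_R G e v \<tau> =
    (exp (\<Lambda> \<tau> - \<Lambda> v) * (X \<tau> - p (r \<tau>)), exp (\<Lambda> \<tau> - \<Lambda> v) * (Y \<tau> - q (r \<tau>)))"
proof -
  have "(LBINT s=ereal \<tau>..ereal v. lambda_R G e s) = (LBINT s=ereal \<tau>..ereal v. lam s)"
    by (simp add: lambda_R_eq[abs_def])
  also have "\<dots> = \<Lambda> v - \<Lambda> \<tau>"
    using \<Lambda> isCont_lam
    by (intro interval_integral_FTC_finite)
      (auto simp: has_real_derivative_iff_has_vector_derivative
        intro: continuous_at_imp_continuous_on has_vector_derivative_at_within)
  finally show ?thesis by (simp add: theta_R_def w_R_eq G_0)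
qed

text \<open>The tangent segments become vertical near minus infinity: their slope is the quotient of the
  two components of \<open>theta_R\<close>. It cannot tend to plus infinity, because it increases with the
  parameter.\<close>

lemma slope_unbounded_below:
  assumes E: "\<And>s. 0 < E s"
    and lim1: "((\<lambda>s. E s * (X s - p (r s))) \<longlongrightarrow> 0) at_bot"
    and lim2: "((\<lambda>s. E s * (Y s - q (r s))) \<longlongrightarrow> c) at_bot" and c: "c \<noteq> 0"
  shows "c < 0" "\<exists>s. tan_slope 0 s < B"
proof -
  have slope: "E s * (Y s - q (r s)) = tan_slope e (r s) * (E s * (X s - p (r s)))" for s
    unfolding q_r[of s, symmetric] by (simp add: algebra_simps)
  have pos: "0 < E s * (X s - p (r s))" for s using E[of s] r(1)[of s] by simp
  have "\<forall>\<^sub>F s in at_bot. E s * (Y s - q (r s)) \<le> tan_slope e (r 0) * (E s * (X s - p (r s)))"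
    using eventually_le_at_bot[of 0]
  proof eventually_elim
    case (elim s)
    then have "r s \<le> r 0" using r_mono by (simp add: strict_mono_less_eq)
    then have "tan_slope e (r s) \<le> tan_slope e (r 0)" using free.m_mono by (simp add: strict_mono_less_eq)
    then show ?case unfolding slope using pos[of s] by (simp add: mult_right_mono)
  qed
  then have "c \<le> tan_slope e (r 0) * 0"
    by (intro tendsto_le[OF _ tendsto_mult[OF tendsto_const lim1] lim2]) auto
  then show "c < 0" using c by simp
  have "((\<lambda>s. B * (E s * (X s - p (r s))) - E s * (Y s - q (r s))) \<longlongrightarrow> B * 0 - c) at_bot"
    by (intro tendsto_intros lim1 lim2)
  then have "\<forall>\<^sub>F s in at_bot. 0 < B * (E s * (X s - p (r s))) - E s * (Y s - q (r s))"
    using \<open>c < 0\<close> by (intro order_tendstoD) auto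
  then obtain s where "0 < B * (E s * (X s - p (r s))) - E s * (Y s - q (r s))"
    using eventually_happens'[OF trivial_limit_at_bot_linorder] by blast
  then have "0 < (B - tan_slope e (r s)) * (E s * (X s - p (r s)))"
    unfolding slope by (simp add: algebra_simps)
  then have "tan_slope e (r s) < B" using pos[of s] by (simp add: zero_less_mult_iff)
  moreover obtain b where "X b < p (r s)" "b < s" "free.L (r s) (X b) = Y b" using left_end .
  then have "tan_slope 0 b < tan_slope e (r s)"
    using fixed.chord_slope_left[of b s "q (r s) - tan_slope e (r s) * p (r s)" "tan_slope e (r s)"]
      r(2)[of s] by (simp add: tangent_as_line)
  ultimately show "\<exists>s. tan_slope 0 s < B" by (meson less_trans)
qed

text \<open>With \<open>X\<close> as the independent variable, \<open>frak_K\<close> is the quotient of the second derivatives of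
  \<open>f\<close> and \<open>Y\<close>. Integrating once from a fixed point, \<open>f' \<le> (N + 1) Y' + const\<close> to the left of it,
  and the constant is absorbed because \<open>Y'\<close> tends to minus infinity.\<close>

lemma f_dominates_Y:
  assumes f: "C2_real f" and K: "filterlim (frak_K G f) at_top at_bot"
    and k: "\<And>B. \<exists>s. tan_slope 0 s < B"
  obtains t0 where "\<And>s t. s \<le> t \<Longrightarrow> t \<le> t0 \<Longrightarrow> f t + N * (Y s - Y t) \<le> f s"
proof -
  note D = crv_derivs[OF zero_in_range] and Xpos = fixed.x'_pos
  have f': "(f has_real_derivative deriv f s) (at s)"
      "(deriv f has_real_derivative deriv (deriv f) s) (at s)" for s
    using f unfolding C2_real_def by (simp_all add: DERIV_deriv_iff_real_differentiable)
  have k3: "(kappa3 G f has_real_derivative deriv (kappa3 G f) s) (at s)" for s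
  proof -
    have "kappa3 G f differentiable (at s)"
      unfolding kappa3_def[abs_def]
      using f'(2)[of s] D(2)[of s] Xpos[of s]
      by (intro differentiable_divide) (auto simp: real_differentiable_def)
    then show ?thesis by (simp add: DERIV_deriv_iff_real_differentiable)
  qed
  have dk: "deriv (kappa2 G) s = tan_slope' 0 s" for s
    unfolding kappa2_eq using fixed.m_deriv by (rule DERIV_imp_deriv)
  obtain t1 where t1: "\<And>s. s \<le> t1 \<Longrightarrow> N + 1 \<le> frak_K G f s"
    using K unfolding filterlim_at_top eventually_at_bot_linorder by blast
  define d where "d s = kappa3 G f s - (N + 1) * tan_slope 0 s" for s
  have d: "d s \<le> d t1" if "s \<le> t1" for s
  proof (rule DERIV_nonneg_imp_nondecreasing[OF that])
    fix z assume "s \<le> z" "z \<le> t1"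
    have "(d has_real_derivative deriv (kappa3 G f) z - (N + 1) * tan_slope' 0 z) (at z)"
      unfolding d_def by (auto intro!: derivative_eq_intros k3 fixed.m_deriv)
    moreover have "(N + 1) * tan_slope' 0 z \<le> deriv (kappa3 G f) z"
      using t1[OF \<open>z \<le> t1\<close>] fixed.m'_pos[of z] by (simp add: frak_K_def dk field_simps)
    ultimately show "\<exists>y. (d has_real_derivative y) (at z) \<and> 0 \<le> y" by fastforce
  qed
  obtain t2 where t2: "tan_slope 0 t2 < - d t1" using k by blast
  define t0 where "t0 = min t1 t2"
  have le: "deriv f s \<le> N * (tan_slope 0 s * deriv X s)" if "s \<le> t0" for s
  proof -
    have "tan_slope 0 s \<le> tan_slope 0 t2"
      using that fixed.m_mono by (simp add: t0_def strict_mono_less_eq)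
    moreover have "d s \<le> d t1" using d that by (simp add: t0_def)
    ultimately have "kappa3 G f s \<le> N * tan_slope 0 s"
      using t2 by (simp add: d_def algebra_simps)
    then have "kappa3 G f s * deriv X s \<le> N * tan_slope 0 s * deriv X s"
      using Xpos[of s] by (simp add: mult_right_mono)
    then show ?thesis using Xpos[of s] by (simp add: kappa3_def mult.assoc)
  qed
  have "f t - N * Y t \<le> f s - N * Y s" if "s \<le> t" "t \<le> t0" for s t
  proof (rule DERIV_nonpos_imp_nonincreasing[OF that(1)])
    fix z assume "s \<le> z" "z \<le> t"
    have "((\<lambda>s. f s - N * Y s) has_real_derivative
        deriv f z - N * (tan_slope 0 z * deriv X z)) (at z)"
      by (auto intro!: derivative_eq_intros f' fixed.y_deriv)
    then show "\<exists>y. ((\<lambda>s. f s - N * Y s) has_real_derivative y) (at z) \<and> y \<le> 0"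
      using le[of z] that \<open>z \<le> t\<close> by force
  qed
  then show thesis using that[of t0] by (simp add: algebra_simps)
qed

lemma G_inj: "G s 0 = G t 0 \<longleftrightarrow> s = t"
  unfolding G_0 using fixed.x_eq_iff by auto

lemma boundary_fun_G: "boundary_fun G f (G t 0) = f t"
proof -
  have "inj (\<lambda>t. G t 0)" using G_inj by (auto simp: inj_def)
  then show ?thesis by (simp add: boundary_fun_def inv_f_f[of "\<lambda>t. G t 0"])
qed

text \<open>The test function starts at \<open>\<tau>\<close> far to the left and ends on the right tangent through \<open>z\<close>. Its part
  on \<open>[0, E \<tau>]\<close> contributes at least \<open>E \<tau> * f \<tau> + N * E \<tau> * (q (r \<tau>) - Y \<tau>)\<close> to the integral of \<open>f\<close>, and
  \<open>E \<tau> * (q (r \<tau>) - Y \<tau>)\<close> tends to \<open>- c > 0\<close>; all other contributions are bounded below independently of \<open>\<tau>\<close> and \<open>N\<close>,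
  because \<open>f\<close> is bounded below on the left of \<open>t\<close> and \<open>T\<close> is fixed.\<close>

theorem bellman_infinite:
  assumes f: "C2_real f" and K: "filterlim (frak_K G f) at_top at_bot"
    and lim1: "((\<lambda>\<tau>. fst (theta_R G e v \<tau>)) \<longlongrightarrow> 0) at_bot"
    and lim2: "((\<lambda>\<tau>. snd (theta_R G e v \<tau>)) \<longlongrightarrow> c) at_bot" and c0: "c \<noteq> 0"
    and I: "nondeg_interval I" and z: "z \<in> Omega G e - fixed_boundary G"
  shows "bellman G e I f z = \<infinity>"
proof -
  obtain \<Lambda> where \<Lambda>: "\<And>s. (\<Lambda> has_real_derivative lam s) (at s)" using lam_antiderivative by blast
  define E where "E s = exp (\<Lambda> s - \<Lambda> v)" for s
  have E_pos: "0 < E s" for s by (simp add: E_def)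
  have E_deriv: "(E has_real_derivative lam s * E s) (at s)" for s
    unfolding E_def by (auto intro!: derivative_eq_intros \<Lambda>)
  note lims = lim1[unfolded theta_R_eq[OF \<Lambda>] fst_conv, folded E_def]
    lim2[unfolded theta_R_eq[OF \<Lambda>] snd_conv, folded E_def]
  note slopes = slope_unbounded_below[OF E_pos lims c0]
  note growth = f_dominates_Y[OF f K slopes(2)]
  have f_cont: "continuous_on UNIV f"
    using f unfolding C2_real_def
    by (meson continuous_at_imp_continuous_on differentiable_imp_continuous_within)
  obtain z1 z2 where z12: "z = (z1, z2)" by (cases z)
  have "(z1, z2) \<in> band" "(z1, z2) \<notin> range (\<lambda>t. (X t, Y t))"
    using z unfolding Omega_eq_band z12 fixed_boundary_def G_0 by auto
  from band_point_on_right_tangent[OF this] obtain t \<beta> where \<beta>: "0 \<le> \<beta>" "\<beta> < 1"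
    and z1: "z1 = (1 - \<beta>) * p (r t) + \<beta> * X t" and z2: "z2 = (1 - \<beta>) * q (r t) + \<beta> * Y t" .
  \<comment> \<open>The mean over \<open>[0, E t]\<close> is the tangency point; staying at the point with parameter \<open>t\<close> until
    \<open>T\<close> moves the mean along the tangent to \<open>z\<close>.\<close>
  define T where "T = E t / (1 - \<beta>)"
  have ET: "E t = (1 - \<beta>) * T" using \<beta> by (simp add: T_def)
  have Et: "E t \<le> T" using \<beta> E_pos[of t] by (simp add: T_def field_simps)
  \<comment> \<open>Domination with \<open>N = 0\<close> says that \<open>f\<close> is nonincreasing far to the left.\<close>
  obtain C where C: "\<And>s. s \<le> t \<Longrightarrow> - C \<le> f s"
  proof -
    obtain t0 where "\<And>s t. s \<le> t \<Longrightarrow> t \<le> t0 \<Longrightarrow> f t + 0 * (Y s - Y t) \<le> f s"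
      using growth[where N = 0] by blast
    then show thesis using bounded_below_left[OF f_cont, of t0] that by auto
  qed
  obtain A A' where A: "A < A'" "{A<..<A'} \<subseteq> I" "I \<subseteq> {A..A'}" using nondeg_interval_ends[OF I] .
  \<comment> \<open>The affine map \<open>s \<mapsto> l * (s - A)\<close> transports the test functions from \<open>[0, T]\<close> to \<open>I\<close>.\<close>
  define l where "l = T / (A' - A)"
  have l_pos: "0 < l" using A E_pos[of t] \<beta> by (simp add: l_def T_def)
  have lA: "l * (A' - A) = T" using A by (simp add: l_def)
  have large: "\<exists>\<phi>. \<phi> \<in> test_class G e I \<and> average I \<phi> = z
      \<and> has_ext_average I (\<lambda>s. boundary_fun G f (\<phi> s))
      \<and> ereal (N * (- c / 2) / T - C) \<le> ext_average I (\<lambda>s. boundary_fun G f (\<phi> s))" if N: "0 \<le> N" for N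
  proof -
    obtain t0 where t0: "\<And>s t. s \<le> t \<Longrightarrow> t \<le> t0 \<Longrightarrow> f t + N * (Y s - Y t) \<le> f s"
      using growth[where N = N] by blast
    have "\<forall>\<^sub>F s in at_bot. E s * (Y s - q (r s)) < c / 2 \<and> s \<le> t0 \<and> s \<le> t"
      using slopes(1) by (intro eventually_conj order_tendstoD(2)[OF lims(2)] eventually_le_at_bot) simp
    then obtain \<tau> where \<tau>: "E \<tau> * (Y \<tau> - q (r \<tau>)) < c / 2" "\<tau> \<le> t0" "\<tau> \<le> t"
      using eventually_happens'[OF trivial_limit_at_bot_linorder] by blast
    obtain b where b: "X b < p (r \<tau>)" "b < \<tau>" "free.L (r \<tau>) (X b) = Y b" using left_end .
    interpret test: band_test p q "tan_slope e" "deriv p" "tan_slope' e" X Y "tan_slope 0" "deriv X"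
      "tan_slope' 0" E b \<tau> t T
      by unfold_locales (rule E_deriv E_pos \<tau>(3) b Et)+
    define \<phi> where "\<phi> s = G (test.\<psi> (l * (s - A))) 0" for s
    have \<phi>: "\<phi> = (\<lambda>s. (X (test.\<psi> (l * (s - A))), Y (test.\<psi> (l * (s - A)))))"
      by (simp add: fun_eq_iff \<phi>_def G_0)
    have "\<phi> \<in> test_class G e I"
    proof -
      have "set_integrable lebesgue I \<phi>"
        unfolding \<phi> using test.curve_psi_integrable[of "\<lambda>s. (X s, Y s)", OF _ A]
        by (simp add: continuous_intros fixed.x_cont fixed.y_cont)
      moreover have "average J \<phi> \<in> Omega G e" if J: "J \<subseteq> I" "nondeg_interval J" for J
      proof -
        obtain a d where ad: "a < d" "{a<..<d} \<subseteq> J" "J \<subseteq> {a..d}" using nondeg_interval_ends[OF J(2)] .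
        have "A \<le> a"
        proof (rule ccontr)
          assume "\<not> A \<le> a"
          then obtain y where "a < y" "y < d" "y < A" using dense[of a "min A d"] ad(1) by auto
          then show False using ad(2) J(1) A(3) by fastforce
        qed
        then have "0 \<le> l * (a - A)" "l * (a - A) < l * (d - A)" using l_pos ad(1) by simp_all
        then show ?thesis
          unfolding Omega_eq_band \<phi> test.average_test[OF ad l_pos] by (rule test.mean_in_band)
      qed
      ultimately show ?thesis
        unfolding test_class_def by (auto simp: \<phi>_def fixed_boundary_def)
    qed
    moreover have "average I \<phi> = z"
    proof -
      have "E t * p (r t) + (T - E t) * X t = T * z1" "E t * q (r t) + (T - E t) * Y t = T * z2"
        unfolding ET z1 z2 by (simp_all add: algebra_simps)
      then show ?thesis
        unfolding \<phi> test.average_test[OF A l_pos] lA z12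
        using test.T_pos test.prim_0 test.prim_T[of "\<lambda>s. p (r s)" X, OF test.join_X]
          test.prim_T[of "\<lambda>s. q (r s)" Y, OF test.join_Y]
        by simp
    qed
    moreover
    have bf: "(\<lambda>s. boundary_fun G f (\<phi> s)) = (\<lambda>s. f (test.\<psi> (l * (s - A))))"
      by (simp add: fun_eq_iff \<phi>_def boundary_fun_G)
    have int: "set_integrable lebesgue I (\<lambda>s. f (test.\<psi> (l * (s - A))))"
      using test.curve_psi_integrable[OF f_cont A] .
    have meas: "measure lebesgue I = A' - A" using sets_measure_between(2)[OF A] .
    then have "0 < measure lebesgue I" using A by simp
    note ext = ext_average_integrable[OF int this]
    have "N * (- c / 2) / T - C \<le> set_lebesgue_integral lebesgue I (\<lambda>s. f (test.\<psi> (l * (s - A)))) / (A' - A)"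
    proof -
      have "(\<lambda>s. f (test.\<psi> s)) integrable_on {0..T}"
        using set_lebesgue_integral_eq_integral(1)[OF test.curve_psi_integrable[OF f_cont test.T_pos
          greaterThanLessThan_subseteq_atLeastAtMost_iff[THEN iffD2] order_refl, of 1 0]] by simp
      then obtain i where i: "((\<lambda>s. f (test.\<psi> s)) has_integral i) {0..T}" by blast
      have "N * (- c / 2) - C * T \<le> N * (E \<tau> * (q (r \<tau>) - Y \<tau>)) - C * T"
        using \<tau>(1) N by (intro diff_right_mono mult_left_mono) (auto simp: algebra_simps)
      also have "\<dots> \<le> i"
        using test.integral_f_lower_bound[OF f_cont _ C i] t0[of b \<tau>] b(2) \<tau>(2) by simp
      finally have i_ge: "N * (- c / 2) - C * T \<le> i" .
      have "((\<lambda>s. f (test.\<psi> (l * (s - A)))) has_integral i / l) {A..A'}"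
        using has_integral_affinity'[of "\<lambda>s. f (test.\<psi> s)" i 0 T l "- l * A"] i l_pos lA[symmetric]
        by (simp add: algebra_simps add_divide_distrib diff_divide_distrib divide_inverse)
      then have "set_lebesgue_integral lebesgue I (\<lambda>s. f (test.\<psi> (l * (s - A)))) = i / l"
        by (rule set_integral_between[OF A int])
      moreover have "i / l / (A' - A) = i / T" by (simp flip: lA)
      moreover have "N * (- c / 2) / T - C \<le> i / T"
        using divide_right_mono[OF i_ge, of T] test.T_pos by (simp add: diff_divide_distrib)
      ultimately show ?thesis by (simp only:)
    qed
    then have "ereal (N * (- c / 2) / T - C) \<le> ext_average I (\<lambda>s. f (test.\<psi> (l * (s - A))))"
      unfolding ext(2) meas by simp
    ultimately show ?thesis using ext(1) unfolding bf[symmetric] by blast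
  qed
  show ?thesis
  proof (rule ereal_top)
    fix B :: real
    define N where "N = \<bar>B + C\<bar> * T / (- c / 2)"
    have T: "0 < T" using Et E_pos[of t] by simp
    then have "0 \<le> N" using slopes(1) by (simp add: N_def divide_nonneg_neg)
    have "N * (- c / 2) = \<bar>B + C\<bar> * T" using slopes(1) by (simp add: N_def)
    then have "N * (- c / 2) / T = \<bar>B + C\<bar>" using T by simp
    then have "ereal B \<le> ereal (N * (- c / 2) / T - C)" by simp
    also obtain \<phi> where "\<phi> \<in> test_class G e I" "average I \<phi> = z"
      "has_ext_average I (\<lambda>s. boundary_fun G f (\<phi> s))"
      "ereal (N * (- c / 2) / T - C) \<le> ext_average I (\<lambda>s. boundary_fun G f (\<phi> s))"
      using large[OF \<open>0 \<le> N\<close>] by blast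
    then have "ereal (N * (- c / 2) / T - C) \<le> bellman G e I f z"
      unfolding bellman_def by (intro Sup_upper2[of "ext_average I (\<lambda>s. boundary_fun G f (\<phi> s))"]) auto
    finally show "ereal B \<le> bellman G e I f z" .
  qed
qed

end

theorem proposition5p4p17:
  fixes emax :: ereal and G :: "real \<Rightarrow> real \<Rightarrow> real \<times> real"
    and e v :: real and f :: "real \<Rightarrow> real"
  assumes "curve_family emax G"
    and "0 < e" and "ereal e < emax"
    and "regular_function G f"
    and "(\<integral>\<^sup>+s\<in>{..v}. ennreal (lambda_R G e s) \<partial>lborel) = \<infinity>"
    and "((\<lambda>\<tau>. fst (theta_R G e v \<tau>)) \<longlongrightarrow> 0) at_bot"
    and "\<exists>c. c \<noteq> 0 \<and> ((\<lambda>\<tau>. snd (theta_R G e v \<tau>)) \<longlongrightarrow> c) at_bot"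
    and "filterlim (frak_K G f) at_top at_bot"
  shows "\<forall>I. nondeg_interval I \<longrightarrow>
           (\<forall>x \<in> Omega G e - fixed_boundary G. bellman G e I f x = \<infinity>)"
proof -
  interpret curve_family emax G by (rule assms(1))
  interpret curve_family_at emax G e by unfold_locales (rule assms)+
  obtain c where "c \<noteq> 0" "((\<lambda>\<tau>. snd (theta_R G e v \<tau>)) \<longlongrightarrow> c) at_bot" using assms(7) by blast
  moreover have "C2_real f" using assms(4) by (simp add: regular_function_def)
  ultimately show ?thesis using bellman_infinite assms(6,8) by blast
qed

end
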